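(* Let $\Omega$ be a bounded domain in $\mathbb{R}^m$, $m\ge2$, and let $\vec F=(F_1,\dots,F_m)$ be a vector field on $\Omega$ with $F_I\in C^1(\Omega)$. Suppose $u\in C^2(\Omega)\cap C^0(\bar\Omega)$ is a $C^2$-smooth solution to $$\operatorname{div}\frac{\nabla u+\vec F}{|\nabla u+\vec F|}=H$$ with $H\in C^0(\Omega\setminus S(u))\cap L^\infty(\Omega)$. Suppose that $$\left[\frac{\operatorname{rank}\,(\partial_JF_I-\partial_IF_J)(p)+1}{2}\right]\ge2\qquad\text{for all }p\in\Omega.$$ Then $u$ is a weak solution to this equation in $\Omega$; and if in addition $u\in W^{1,1}(\Omega)$ (and $\vec F\in L^1(\Omega)$), then $u$ is a minimizer for $\mathcal{F}(u)=\int_\Omega\{|\nabla u+\vec F|+Hu\}$.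
   Context: $S(u)=\{\nabla u+\vec F=0\}$ is the singular set of $u$, and $N(u)=\frac{\nabla u+\vec F}{|\nabla u+\vec F|}$ on $\Omega\setminus S(u)$. $u\in C^2(\Omega)$ is a $C^2$-smooth solution to $\operatorname{div}N(u)=H$ if the equation holds in $\Omega\setminus S(u)$. $[x]$ denotes the largest integer $\le x$. $(\partial_JF_I-\partial_IF_J)(p)$ is the $m\times m$ matrix indexed by $I,J$, evaluated at $p$. Weak solution (for $\vec F\in L^1_{loc}(\Omega)$, $H\in L^1_{loc}(\Omega)$): $u\in W^1(\Omega)$ (the space of weakly differentiable functions on $\Omega$) is a weak solution to $\operatorname{div}N(u)=H$ in $\Omega$ if for every $\varphi\in C_0^\infty(\Omega)$ $$\int_{S(u)}|\nabla\varphi|+\int_{\Omega\setminus S(u)}N(u)\cdot\nabla\varphi+\int_\Omega H\varphi\ge0.$$ Minimizer (for $\vec F\in L^1(\Omega)$, $H\in L^\infty(\Omega)$): $u\in W^{1,1}(\Omega)$ is a minimizer for $\mathcal{F}$ if $\mathcal{F}(u)\le\mathcal{F}(u+\varphi)$ for every $\varphi\in W^{1,1}_0(\Omega)$. *)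

theory Defs
  imports "HOL-Analysis.Analysis"
begin

subsection \<open>Classical derivatives\<close>

definition partial_deriv :: "'n::finite \<Rightarrow> (real^'n \<Rightarrow> real) \<Rightarrow> real^'n \<Rightarrow> real" where
  "partial_deriv i f x = frechet_derivative f (at x) (axis i 1)"

definition grad :: "(real^'n::finite \<Rightarrow> real) \<Rightarrow> real^'n \<Rightarrow> real^'n" where
  "grad f x = (\<chi> i. partial_deriv i f x)"

definition divergence :: "(real^'n::finite \<Rightarrow> real^'n) \<Rightarrow> real^'n \<Rightarrow> real" where
  "divergence X x = (\<Sum>i\<in>UNIV. partial_deriv i (\<lambda>y. X y $ i) x)"

text \<open>\<open>Ck_on k f S\<close> is meant for open \<open>S\<close> only; differentiability is stated with the full
  neighbourhood filter.\<close>

fun Ck_on :: "nat \<Rightarrow> (real^'n::finite \<Rightarrow> real) \<Rightarrow> (real^'n) set \<Rightarrow> bool" where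
  "Ck_on 0 f S \<longleftrightarrow> continuous_on S f"
| "Ck_on (Suc k) f S \<longleftrightarrow>
     (\<forall>x\<in>S. f differentiable (at x)) \<and> (\<forall>i. Ck_on k (partial_deriv i f) S)"

text \<open>Elements of \<open>C\<^sub>0\<^sup>\<infinity>(\<Omega>)\<close>, extended by zero to the whole space.\<close>

definition test_fun :: "(real^'n::finite) set \<Rightarrow> (real^'n \<Rightarrow> real) \<Rightarrow> bool" where
  "test_fun \<Omega> \<phi> \<longleftrightarrow> (\<forall>k. Ck_on k \<phi> UNIV) \<and>
     compact (closure {x. \<phi> x \<noteq> 0}) \<and> closure {x. \<phi> x \<noteq> 0} \<subseteq> \<Omega>"

subsection \<open>Function spaces\<close>

text \<open>In the following, functions on \<open>\<Omega>\<close> are total functions whose values outside \<open>\<Omega>\<close> are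
  irrelevant.\<close>

definition L1_loc :: "(real^'n::finite) set \<Rightarrow> (real^'n \<Rightarrow> 'b::euclidean_space) \<Rightarrow> bool" where
  "L1_loc \<Omega> f \<longleftrightarrow> (\<forall>K. compact K \<and> K \<subseteq> \<Omega> \<longrightarrow> integrable (lebesgue_on K) f)"

definition L_infty :: "(real^'n::finite) set \<Rightarrow> (real^'n \<Rightarrow> real) \<Rightarrow> bool" where
  "L_infty \<Omega> f \<longleftrightarrow> f \<in> borel_measurable (lebesgue_on \<Omega>) \<and>
     (\<exists>C. AE x in lebesgue_on \<Omega>. \<bar>f x\<bar> \<le> C)"

definition has_weak_grad ::
    "(real^'n::finite) set \<Rightarrow> (real^'n \<Rightarrow> real) \<Rightarrow> (real^'n \<Rightarrow> real^'n) \<Rightarrow> bool" where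
  "has_weak_grad \<Omega> u G \<longleftrightarrow> L1_loc \<Omega> u \<and> L1_loc \<Omega> G \<and>
     (\<forall>\<phi> i. test_fun \<Omega> \<phi> \<longrightarrow>
        (LINT x|lebesgue_on \<Omega>. u x * partial_deriv i \<phi> x) =
        - (LINT x|lebesgue_on \<Omega>. G x $ i * \<phi> x))"

definition weakly_differentiable :: "(real^'n::finite) set \<Rightarrow> (real^'n \<Rightarrow> real) \<Rightarrow> bool" where
  "weakly_differentiable \<Omega> u \<longleftrightarrow> (\<exists>G. has_weak_grad \<Omega> u G)"

text \<open>On an open set weak gradients are unique up to null sets. Choosing a representative only
  affects the integrals below through null sets, that is, not at all.\<close>

definition weak_grad :: "(real^'n::finite) set \<Rightarrow> (real^'n \<Rightarrow> real) \<Rightarrow> real^'n \<Rightarrow> real^'n" where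
  "weak_grad \<Omega> u = (SOME G. has_weak_grad \<Omega> u G)"

definition W11 :: "(real^'n::finite) set \<Rightarrow> (real^'n \<Rightarrow> real) \<Rightarrow> bool" where
  "W11 \<Omega> u \<longleftrightarrow> weakly_differentiable \<Omega> u \<and> integrable (lebesgue_on \<Omega>) u \<and>
     integrable (lebesgue_on \<Omega>) (weak_grad \<Omega> u)"

definition W11_norm :: "(real^'n::finite) set \<Rightarrow> (real^'n \<Rightarrow> real) \<Rightarrow> real" where
  "W11_norm \<Omega> u =
     (LINT x|lebesgue_on \<Omega>. \<bar>u x\<bar>) + (LINT x|lebesgue_on \<Omega>. norm (weak_grad \<Omega> u x))"

text \<open>\<open>W11_0\<close> is the closure of \<open>C\<^sub>0\<^sup>\<infinity>(\<Omega>)\<close> in the norm of \<open>W11\<close>.\<close>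

definition W11_0 :: "(real^'n::finite) set \<Rightarrow> (real^'n \<Rightarrow> real) \<Rightarrow> bool" where
  "W11_0 \<Omega> \<phi> \<longleftrightarrow> W11 \<Omega> \<phi> \<and>
     (\<forall>\<epsilon>>0. \<exists>\<psi>. test_fun \<Omega> \<psi> \<and> W11_norm \<Omega> (\<lambda>x. \<phi> x - \<psi> x) < \<epsilon>)"

subsection \<open>The equation and the functional\<close>

text \<open>The singular set and the unit field \<open>N\<close> take the gradient field \<open>G\<close> of the unknown
  as a parameter, so that they serve both for the classical gradient (\<open>G = grad u\<close>) and for the weak
  gradient (\<open>G = weak_grad \<Omega> u\<close>).\<close>

definition sing_set ::
    "(real^'n::finite) set \<Rightarrow> (real^'n \<Rightarrow> real^'n) \<Rightarrow> (real^'n \<Rightarrow> real^'n) \<Rightarrow> (real^'n) set" where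
  "sing_set \<Omega> F G = {x \<in> \<Omega>. G x + F x = 0}"

definition unit_field ::
    "(real^'n::finite \<Rightarrow> real^'n) \<Rightarrow> (real^'n \<Rightarrow> real^'n) \<Rightarrow> real^'n \<Rightarrow> real^'n" where
  "unit_field F G x = (1 / norm (G x + F x)) *\<^sub>R (G x + F x)"

definition C2_smooth_solution ::
    "(real^'n::finite) set \<Rightarrow> (real^'n \<Rightarrow> real^'n) \<Rightarrow> (real^'n \<Rightarrow> real) \<Rightarrow> (real^'n \<Rightarrow> real) \<Rightarrow> bool" where
  "C2_smooth_solution \<Omega> F H u \<longleftrightarrow> Ck_on 2 u \<Omega> \<and>
     (\<forall>x \<in> \<Omega> - sing_set \<Omega> F (grad u). divergence (unit_field F (grad u)) x = H x)"

definition weak_solution ::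
    "(real^'n::finite) set \<Rightarrow> (real^'n \<Rightarrow> real^'n) \<Rightarrow> (real^'n \<Rightarrow> real) \<Rightarrow> (real^'n \<Rightarrow> real) \<Rightarrow> bool" where
  "weak_solution \<Omega> F H u \<longleftrightarrow> L1_loc \<Omega> F \<and> L1_loc \<Omega> H \<and> weakly_differentiable \<Omega> u \<and>
     (\<forall>\<phi>. test_fun \<Omega> \<phi> \<longrightarrow>
        (LINT x|lebesgue_on (sing_set \<Omega> F (weak_grad \<Omega> u)). norm (grad \<phi> x)) +
        (LINT x|lebesgue_on (\<Omega> - sing_set \<Omega> F (weak_grad \<Omega> u)).
            unit_field F (weak_grad \<Omega> u) x \<bullet> grad \<phi> x) +
        (LINT x|lebesgue_on \<Omega>. H x * \<phi> x) \<ge> 0)"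

definition energy ::
    "(real^'n::finite) set \<Rightarrow> (real^'n \<Rightarrow> real^'n) \<Rightarrow> (real^'n \<Rightarrow> real) \<Rightarrow> (real^'n \<Rightarrow> real) \<Rightarrow> real" where
  "energy \<Omega> F H u = (LINT x|lebesgue_on \<Omega>. norm (weak_grad \<Omega> u x + F x) + H x * u x)"

definition minimizer ::
    "(real^'n::finite) set \<Rightarrow> (real^'n \<Rightarrow> real^'n) \<Rightarrow> (real^'n \<Rightarrow> real) \<Rightarrow> (real^'n \<Rightarrow> real) \<Rightarrow> bool" where
  "minimizer \<Omega> F H u \<longleftrightarrow> integrable (lebesgue_on \<Omega>) F \<and> L_infty \<Omega> H \<and> W11 \<Omega> u \<and>
     (\<forall>\<phi>. W11_0 \<Omega> \<phi> \<longrightarrow> energy \<Omega> F H u \<le> energy \<Omega> F H (\<lambda>x. u x + \<phi> x))"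

definition curl_matrix :: "(real^'n::finite \<Rightarrow> real^'n) \<Rightarrow> real^'n \<Rightarrow> real^'n^'n" where
  "curl_matrix F p =
     (\<chi> I J. partial_deriv J (\<lambda>x. F x $ I) p - partial_deriv I (\<lambda>x. F x $ J) p)"

end

theory Submission
  imports Defs
begin

text \<open>
  The rank condition says that the skew part of the derivative of \<open>G = \<nabla>u + F\<close> has rank at least
  three, so \<open>DG\<close> itself has rank at least two: at every point \<open>p\<close> two columns \<open>k, l\<close> of \<open>DG p\<close> are
  linearly independent, and near \<open>p\<close> the map \<open>G\<close> is injective with Lipschitz inverse along planes parallel to
  \<open>e\<^sub>k, e\<^sub>l\<close>. Hence many disjoint translates of a sublevel set \<open>{\<bar>G\<bar> \<le> \<delta>}\<close> fit into a ball, and its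
  measure is locally \<open>O(\<delta>\<^sup>2)\<close>. In particular the singular set \<open>{G = 0}\<close> is a null set.

  Moreover it is too small to carry a contribution to the divergence of \<open>N = G / \<bar>G\<bar>\<close>: the fields
  \<open>G / sqrt (\<bar>G\<bar>\<^sup>2 + \<epsilon>\<^sup>2) = \<lambda> N\<close> are \<open>C\<^sup>1\<close>, their divergence off the singular set is \<open>\<lambda> H + N \<cdot> \<nabla>\<lambda>\<close>, and
  \<open>\<bar>\<nabla>\<lambda>\<bar> = O(\<epsilon>\<^sup>2 (\<bar>G\<bar>\<^sup>2 + \<epsilon>\<^sup>2)\<^bsup>-3/2\<^esup>)\<close>, which by the measure bound tends to \<open>0\<close> in \<open>L\<^sup>1\<close> on compact sets.
  So \<open>\<integral>N \<cdot> \<nabla>\<phi> + \<integral>H \<phi> = 0\<close> for test functions, and by density for \<open>\<phi>\<close> in the closure of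
  the test functions in \<open>W\<^sup>1\<^sup>,\<^sup>1\<close>. Minimality follows from \<open>\<bar>G + \<nabla>\<phi>\<bar> \<ge> \<bar>G\<bar> + N \<cdot> \<nabla>\<phi>\<close>.
\<close>

subsection \<open>Classical derivatives\<close>

lemma partial_deriv_eqI:
  assumes "(f has_derivative D) (at x)"
  shows "partial_deriv i f x = D (axis i 1)"
  using frechet_derivative_at[OF assms] by (simp add: partial_deriv_def)

lemma has_derivative_grad:
  assumes "f differentiable (at x)"
  shows "(f has_derivative (\<lambda>h. grad f x \<bullet> h)) (at x)"
proof -
  obtain D where D: "(f has_derivative D) (at x)"
    using assms by (auto simp: differentiable_def)
  interpret bounded_linear D using D by (rule has_derivative_bounded_linear)
  have "D h = grad f x \<bullet> h" for h
  proof -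
    have "D h = D (\<Sum>i\<in>UNIV. h $ i *\<^sub>R axis i 1)"
      using basis_expansion[of h] by (simp add: scalar_mult_eq_scaleR)
    also have "\<dots> = (\<Sum>i\<in>UNIV. h $ i * partial_deriv i f x)"
      by (simp add: sum scaleR partial_deriv_eqI[OF D])
    finally show ?thesis by (simp add: grad_def inner_vec_def mult.commute)
  qed
  then have "D = (\<lambda>h. grad f x \<bullet> h)" by auto
  with D show ?thesis by simp
qed

lemma grad_nth [simp]: "grad f x $ i = partial_deriv i f x"
  by (simp add: grad_def)

text \<open>Differentiability plays no part in the argument: \<open>frechet_derivative\<close> is a
  choice from the \<open>has_derivative\<close> predicate, and at x this predicate is the same for
  two functions that agree on a neighbourhood.\<close>

lemma partial_deriv_cong:
  assumes "open S" "x \<in> S" "\<And>y. y \<in> S \<Longrightarrow> f y = g y"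
  shows "partial_deriv i f x = partial_deriv i g x"
proof -
  have "(f has_derivative D) (at x) \<longleftrightarrow> (g has_derivative D) (at x)" for D
    using assms by (metis has_derivative_transform_within_open)
  then show ?thesis by (simp add: partial_deriv_def frechet_derivative_def)
qed

lemma differentiable_cong_open:
  fixes f g :: "'a::real_normed_vector \<Rightarrow> 'b::real_normed_vector"
  assumes "open S" "x \<in> S" "\<And>y. y \<in> S \<Longrightarrow> f y = g y"
  shows "f differentiable (at x) \<longleftrightarrow> g differentiable (at x)"
  using assms unfolding differentiable_def by (metis has_derivative_transform_within_open)

section \<open>Calculus of C^k functions on open sets\<close>

lemma Ck_on_cong:
  assumes "open S" "\<And>y. y \<in> S \<Longrightarrow> f y = g y"
  shows "Ck_on k f S \<longleftrightarrow> Ck_on k g S"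
  using assms(2)
proof (induction k arbitrary: f g)
  case (Suc k)
  have "Ck_on k (partial_deriv i f) S = Ck_on k (partial_deriv i g) S" for i
    using Suc.prems by (intro Suc.IH partial_deriv_cong[OF assms(1)])
  moreover have "(\<forall>x\<in>S. f differentiable (at x)) = (\<forall>x\<in>S. g differentiable (at x))"
    using differentiable_cong_open[OF assms(1)] Suc.prems by blast
  ultimately show ?case by simp
qed (auto intro: continuous_on_cong)

lemma Ck_on_continuous_on: "Ck_on k f S \<Longrightarrow> continuous_on S f"
  by (cases k)
    (auto intro!: differentiable_imp_continuous_on differentiable_at_imp_differentiable_on)

lemma Ck_on_SucD: "Ck_on (Suc k) f S \<Longrightarrow> Ck_on k f S"
proof (induction k arbitrary: f)
  case 0
  then show ?case using Ck_on_continuous_on[of "Suc 0" f S] by (simp only: Ck_on.simps(1))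
next
  case (Suc k)
  have "\<forall>x\<in>S. f differentiable (at x)" "\<And>i. Ck_on (Suc k) (partial_deriv i f) S"
    using Suc.prems by (subst (asm) Ck_on.simps(2), blast)+
  then show ?case using Suc.IH Ck_on.simps(2)[of k f S] by blast
qed

lemma Ck_on_subset: "Ck_on k f S \<Longrightarrow> T \<subseteq> S \<Longrightarrow> Ck_on k f T"
  by (induction k arbitrary: f) (auto intro: continuous_on_subset)

lemma partial_deriv_add:
  assumes "f differentiable (at x)" "g differentiable (at x)"
  shows "partial_deriv i (\<lambda>x. f x + g x) x = partial_deriv i f x + partial_deriv i g x"
  using partial_deriv_eqI[OF has_derivative_add[OF assms[THEN has_derivative_grad]], of i]
  by (simp add: inner_axis)

lemma partial_deriv_mult:
  assumes "f differentiable (at x)" "g differentiable (at x)"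
  shows "partial_deriv i (\<lambda>x. f x * g x) x = f x * partial_deriv i g x + partial_deriv i f x * g x"
  using partial_deriv_eqI[OF has_derivative_mult[OF assms[THEN has_derivative_grad]], of i]
  by (simp add: inner_axis)

lemma partial_deriv_const [simp]: "partial_deriv i (\<lambda>x. c) = (\<lambda>x. 0)"
  using partial_deriv_eqI[OF has_derivative_const] by (rule ext)

lemma Ck_on_const [simp]: "Ck_on k (\<lambda>x. c) S"
  by (induction k arbitrary: c) auto

lemma Ck_on_add:
  assumes "open S" "Ck_on k f S" "Ck_on k g S"
  shows "Ck_on k (\<lambda>x. f x + g x) S"
  using assms(2,3)
proof (induction k arbitrary: f g)
  case (Suc k)
  have "Ck_on k (partial_deriv i (\<lambda>x. f x + g x)) S" for i
  proof -
    have "Ck_on k (\<lambda>x. partial_deriv i f x + partial_deriv i g x) S"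
      using Suc by auto
    then show ?thesis
      by (rule Ck_on_cong[OF assms(1), THEN iffD1, rotated -1])
        (use Suc.prems in \<open>auto simp: partial_deriv_add\<close>)
  qed
  then show ?case using Suc.prems by auto
qed (auto intro: continuous_on_add)

lemma Ck_on_mult:
  assumes "open S" "Ck_on k f S" "Ck_on k g S"
  shows "Ck_on k (\<lambda>x. f x * g x) S"
  using assms(2,3)
proof (induction k arbitrary: f g)
  case (Suc k)
  have "Ck_on k (partial_deriv i (\<lambda>x. f x * g x)) S" for i
  proof -
    \<comment> \<open>The Leibniz rule contains f and g themselves, so the induction hypothesis
      needs them in C^k; \<open>Ck_on_SucD\<close> supplies this.\<close>
    have "Ck_on k (\<lambda>x. f x * partial_deriv i g x + partial_deriv i f x * g x) S"
      using Suc.prems Suc.prems[THEN Ck_on_SucD]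
      by (intro Ck_on_add assms(1) Suc.IH) auto
    then show ?thesis
      by (rule Ck_on_cong[OF assms(1), THEN iffD1, rotated -1])
        (use Suc.prems in \<open>auto simp: partial_deriv_mult\<close>)
  qed
  then show ?case using Suc.prems by auto
qed (auto intro: continuous_on_mult)

lemma Ck_on_sum:
  assumes "open S" "\<And>i. i \<in> I \<Longrightarrow> Ck_on k (f i) S"
  shows "Ck_on k (\<lambda>x. \<Sum>i\<in>I. f i x) S"
  using assms(2) by (induction I rule: infinite_finite_induct) (auto intro: Ck_on_add assms(1))

lemma Ck_on_prod:
  assumes "open S" "\<And>i. i \<in> I \<Longrightarrow> Ck_on k (f i) S"
  shows "Ck_on k (\<lambda>x. \<Prod>i\<in>I. f i x) S"
  using assms(2) by (induction I rule: infinite_finite_induct) (auto intro: Ck_on_mult assms(1))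

lemma Ck_on_power:
  assumes "open S" "Ck_on k f S"
  shows "Ck_on k (\<lambda>x. f x ^ n) S"
  by (induction n) (auto intro: Ck_on_mult assms)

lemma Ck_on_diff:
  assumes "open S" "Ck_on k f S" "Ck_on k g S"
  shows "Ck_on k (\<lambda>x. f x - g x) S"
  using Ck_on_add[OF assms(1,2) Ck_on_mult[OF assms(1) _ assms(3), of "\<lambda>x. -1"]] by simp

lemma C1_on_iff:
  "Ck_on (Suc 0) f S \<longleftrightarrow>
     (\<forall>x\<in>S. f differentiable (at x)) \<and> (\<forall>i. continuous_on S (partial_deriv i f))"
  by simp

lemma
  assumes "f differentiable (at x)" "(h has_real_derivative h') (at (f x))"
  shows differentiable_compose_real: "(\<lambda>y. h (f y)) differentiable (at x)"
    and partial_deriv_compose: "partial_deriv i (\<lambda>y. h (f y)) x = h' * partial_deriv i f x"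
proof -
  have "((\<lambda>y. h (f y)) has_derivative (\<lambda>v. h' * (grad f x \<bullet> v))) (at x)"
    using has_derivative_compose[OF has_derivative_grad[OF assms(1)]
        assms(2)[THEN has_field_derivative_imp_has_derivative]] by simp
  then show "(\<lambda>y. h (f y)) differentiable (at x)"
    "partial_deriv i (\<lambda>y. h (f y)) x = h' * partial_deriv i f x"
    using partial_deriv_eqI[of "\<lambda>y. h (f y)" _ x i] by (auto simp: differentiable_def inner_axis)
qed

text \<open>The outer function is controlled only on a set T containing the range of f. The
  regularisation below uses \<open>T = {0..}\<close> with f the squared norm of a field.\<close>

lemma C1_on_compose:
  assumes "Ck_on (Suc 0) f S" "\<And>t. t \<in> T \<Longrightarrow> (h has_real_derivative h' t) (at t)"
    and "continuous_on T h'" "f ` S \<subseteq> T"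
  shows "Ck_on (Suc 0) (\<lambda>x. h (f x)) S"
  unfolding C1_on_iff
proof (intro conjI ballI allI)
  fix x assume x: "x \<in> S"
  show "(\<lambda>x. h (f x)) differentiable (at x)"
    by (rule differentiable_compose_real[where f = f and h = h and h' = "h' (f x)"])
      (use assms x in auto)
next
  fix i
  have "continuous_on S (\<lambda>x. h' (f x) * partial_deriv i f x)"
    using assms(1,4) by (intro continuous_on_mult continuous_on_compose2[OF assms(3)] Ck_on_continuous_on[OF assms(1)]) auto
  then show "continuous_on S (partial_deriv i (\<lambda>x. h (f x)))"
    by (rule continuous_on_cong[THEN iffD1, OF refl, rotated])
      (rule partial_deriv_compose[symmetric], use assms in \<open>auto simp: image_subset_iff\<close>)
qed

lemma has_real_derivative_line:
  assumes "f differentiable (at (x + t *\<^sub>R axis i 1))"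
  shows "((\<lambda>s. f (x + s *\<^sub>R axis i 1)) has_real_derivative partial_deriv i f (x + t *\<^sub>R axis i 1)) (at t within A)"
proof -
  have "((\<lambda>s. x + s *\<^sub>R axis i 1) has_derivative (\<lambda>s. s *\<^sub>R axis i 1)) (at t within A)"
    by (auto intro!: derivative_eq_intros)
  from has_derivative_compose[OF this has_derivative_grad[OF assms]]
  have "((\<lambda>s. f (x + s *\<^sub>R axis i 1)) has_derivative
      (\<lambda>s. grad f (x + t *\<^sub>R axis i 1) \<bullet> (s *\<^sub>R axis i 1))) (at t within A)" .
  moreover have "(\<lambda>s. grad f (x + t *\<^sub>R axis i 1) \<bullet> (s *\<^sub>R axis i 1))
      = (*) (partial_deriv i f (x + t *\<^sub>R axis i 1))"
    by (simp add: fun_eq_iff inner_axis)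
  ultimately show ?thesis by (simp add: has_field_derivative_def)
qed

section \<open>Symmetry of second derivatives\<close>

text \<open>Two applications of the mean value theorem: first in direction i to the increment of u
  along j, then in direction j to the partial derivative \<open>partial_deriv i u\<close>. The two
  intermediate parameters locate y.\<close>

lemma second_difference_mean_value:
  assumes u: "Ck_on 2 u (ball x r)" and h: "0 < h" "2 * h < r"
  shows "\<exists>y\<in>ball x r. dist x y \<le> 2 * h \<and>
     u (x + h *\<^sub>R axis i 1 + h *\<^sub>R axis j 1) - u (x + h *\<^sub>R axis i 1) - u (x + h *\<^sub>R axis j 1) + u x
       = h\<^sup>2 * partial_deriv j (partial_deriv i u) y"
proof -
  have d: "u differentiable (at y)" "partial_deriv i u differentiable (at y)" if "y \<in> ball x r" for y
    using u that by (auto simp: numeral_2_eq_2)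
  have near: "dist x (x + s *\<^sub>R axis i 1 + t *\<^sub>R axis j 1) \<le> 2 * h"
    if "0 \<le> s" "s \<le> h" "0 \<le> t" "t \<le> h" for s t
    using norm_triangle_ineq[of "s *\<^sub>R axis i (1::real)" "t *\<^sub>R axis j 1"] that
    by (simp add: dist_norm algebra_simps norm_minus_commute)
  then have inb: "x + s *\<^sub>R axis i 1 + t *\<^sub>R axis j 1 \<in> ball x r"
    if "0 \<le> s" "s \<le> h" "0 \<le> t" "t \<le> h" for s t
    using that h by (meson le_less_trans mem_ball)
  define g where "g s = u ((x + h *\<^sub>R axis j 1) + s *\<^sub>R axis i 1) - u (x + s *\<^sub>R axis i 1)" for s
  have "\<exists>s>0. s < h \<and> g h - g 0 = (h - 0) *
      (partial_deriv i u ((x + h *\<^sub>R axis j 1) + s *\<^sub>R axis i 1) - partial_deriv i u (x + s *\<^sub>R axis i 1))"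
    unfolding g_def
  proof (rule MVT2[OF h(1)], intro DERIV_diff has_real_derivative_line d)
    fix s assume "0 \<le> s" "s \<le> h"
    with inb[of s h] inb[of s 0] h
    show "x + h *\<^sub>R axis j 1 + s *\<^sub>R axis i 1 \<in> ball x r" "x + s *\<^sub>R axis i 1 \<in> ball x r"
      by (simp_all add: add_ac)
  qed
  then obtain s where s: "0 < s" "s < h" "g h - g 0 = h *
      (partial_deriv i u ((x + h *\<^sub>R axis j 1) + s *\<^sub>R axis i 1) - partial_deriv i u (x + s *\<^sub>R axis i 1))"
    by auto
  have "\<exists>t>0. t < h \<and> partial_deriv i u ((x + s *\<^sub>R axis i 1) + h *\<^sub>R axis j 1) - partial_deriv i u ((x + s *\<^sub>R axis i 1) + 0 *\<^sub>R axis j 1)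
     = (h - 0) * partial_deriv j (partial_deriv i u) ((x + s *\<^sub>R axis i 1) + t *\<^sub>R axis j 1)"
    by (rule MVT2) (use h s inb[of s] in \<open>auto intro!: has_real_derivative_line d\<close>)
  then obtain t where t: "0 < t" "t < h" "partial_deriv i u (x + s *\<^sub>R axis i 1 + h *\<^sub>R axis j 1) - partial_deriv i u (x + s *\<^sub>R axis i 1)
     = h * partial_deriv j (partial_deriv i u) (x + s *\<^sub>R axis i 1 + t *\<^sub>R axis j 1)"
    by auto
  have "u (x + h *\<^sub>R axis i 1 + h *\<^sub>R axis j 1) - u (x + h *\<^sub>R axis i 1) - u (x + h *\<^sub>R axis j 1) + u x = g h - g 0"
    by (simp add: g_def algebra_simps)
  also have "\<dots> = h\<^sup>2 * partial_deriv j (partial_deriv i u) (x + s *\<^sub>R axis i 1 + t *\<^sub>R axis j 1)"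
    using s t by (simp add: algebra_simps power2_eq_square)
  finally show ?thesis
    using near[of s t] inb[of s t] s t by (intro bexI[of _ "x + s *\<^sub>R axis i 1 + t *\<^sub>R axis j 1"]) auto
qed

text \<open>The second difference is symmetric in i and j. Divided by \<open>h\<^sup>2\<close> it
  equals either mixed derivative at points converging to x, so by continuity both mixed derivatives
  at x are limits of the same sequence.\<close>

lemma partial_deriv_commute:
  assumes u: "Ck_on 2 u S" and "open S" "x \<in> S"
  shows "partial_deriv i (partial_deriv j u) x = partial_deriv j (partial_deriv i u) x"
proof -
  obtain r where r: "r > 0" "ball x r \<subseteq> S"
    using assms open_contains_ball by blast
  note u' = Ck_on_subset[OF u r(2)]
  \<comment> \<open>The factor r / 4 keeps \<open>2 * h n\<close> at most r / 2, within the range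
    allowed by the mean value lemma.\<close>
  define h where "h n = r / 4 * inverse (real (Suc n))" for n
  have h0: "h \<longlonglongrightarrow> 0"
    unfolding h_def using tendsto_mult_right_zero[OF LIMSEQ_inverse_real_of_nat] by blast
  have hp: "0 < h n" "2 * h n < r" for n
  proof -
    have "inverse (real (Suc n)) \<le> 1" by (simp add: divide_simps)
    then have "h n \<le> r / 4 * 1" unfolding h_def using r by (intro mult_left_mono) auto
    then show "0 < h n" "2 * h n < r" using r by (auto simp: h_def)
  qed
  have lim: "\<exists>y. (\<forall>n. h n ^ 2 * partial_deriv j (partial_deriv i u) (y n) =
      u (x + h n *\<^sub>R axis i 1 + h n *\<^sub>R axis j 1) - u (x + h n *\<^sub>R axis i 1) - u (x + h n *\<^sub>R axis j 1) + u x) \<and>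
      (\<lambda>n. partial_deriv j (partial_deriv i u) (y n)) \<longlonglongrightarrow> partial_deriv j (partial_deriv i u) x" for i j
  proof -
    obtain y where y: "\<And>n. y n \<in> ball x r" "\<And>n. dist x (y n) \<le> 2 * h n"
      "\<And>n. u (x + h n *\<^sub>R axis i 1 + h n *\<^sub>R axis j 1) - u (x + h n *\<^sub>R axis i 1) - u (x + h n *\<^sub>R axis j 1) + u x
       = h n ^ 2 * partial_deriv j (partial_deriv i u) (y n)"
      using second_difference_mean_value[OF u' hp, of _ i j] unfolding Bex_def by metis
    have "(\<lambda>n. dist (y n) x) \<longlonglongrightarrow> 0"
      by (rule tendsto_sandwich[OF _ _ tendsto_const tendsto_mult_right_zero[OF h0, of 2]])
        (use y in \<open>auto simp: dist_commute\<close>)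
    then have "y \<longlonglongrightarrow> x" by (rule tendsto_dist_iff[THEN iffD2])
    moreover have "continuous_on (ball x r) (partial_deriv j (partial_deriv i u))"
      using u' by (auto simp: numeral_2_eq_2)
    ultimately have "(\<lambda>n. partial_deriv j (partial_deriv i u) (y n)) \<longlonglongrightarrow> partial_deriv j (partial_deriv i u) x"
      using r y by (intro continuous_on_tendsto_compose[of "ball x r" "partial_deriv j (partial_deriv i u)"]) auto
    with y show ?thesis by auto
  qed
  obtain y where y: "\<And>n. h n ^ 2 * partial_deriv j (partial_deriv i u) (y n) =
      u (x + h n *\<^sub>R axis i 1 + h n *\<^sub>R axis j 1) - u (x + h n *\<^sub>R axis i 1) - u (x + h n *\<^sub>R axis j 1) + u x"
      "(\<lambda>n. partial_deriv j (partial_deriv i u) (y n)) \<longlonglongrightarrow> partial_deriv j (partial_deriv i u) x"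
    using lim[where i = i and j = j] by blast
  obtain z where z: "\<And>n. h n ^ 2 * partial_deriv i (partial_deriv j u) (z n) =
      u (x + h n *\<^sub>R axis j 1 + h n *\<^sub>R axis i 1) - u (x + h n *\<^sub>R axis j 1) - u (x + h n *\<^sub>R axis i 1) + u x"
      "(\<lambda>n. partial_deriv i (partial_deriv j u) (z n)) \<longlonglongrightarrow> partial_deriv i (partial_deriv j u) x"
    using lim[where i = j and j = i] by blast
  have "h n ^ 2 * partial_deriv j (partial_deriv i u) (y n) = h n ^ 2 * partial_deriv i (partial_deriv j u) (z n)" for n
    unfolding y(1) z(1) by (simp add: add_ac)
  then have "partial_deriv j (partial_deriv i u) (y n) = partial_deriv i (partial_deriv j u) (z n)" for n
    using hp(1)[of n] by (metis less_irrefl mult_left_cancel power_not_zero)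
  then show ?thesis using LIMSEQ_unique[OF y(2)] z(2) by simp
qed

subsection \<open>Integration by parts\<close>

lemma integrable_scaleR_bounded:
  fixes f :: "'a \<Rightarrow> 'b::{banach, second_countable_topology}" and g :: "'a \<Rightarrow> real"
  assumes f: "integrable M f" and [measurable]: "g \<in> borel_measurable M"
    and B: "AE x in M. \<bar>g x\<bar> \<le> B"
  shows "integrable M (\<lambda>x. g x *\<^sub>R f x)"
proof (rule Bochner_Integration.integrable_bound)
  show "integrable M (\<lambda>x. B *\<^sub>R f x)" using f by simp
  show "(\<lambda>x. g x *\<^sub>R f x) \<in> borel_measurable M"
    using borel_measurable_integrable[OF f] by measurable
  show "AE x in M. norm (g x *\<^sub>R f x) \<le> norm (B *\<^sub>R f x)"
    using B by eventually_elim (auto intro!: mult_right_mono)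
qed

lemma integrable_mult_bounded:
  fixes f g :: "'a \<Rightarrow> real"
  assumes "integrable M f" "g \<in> borel_measurable M" "AE x in M. \<bar>g x\<bar> \<le> B"
  shows "integrable M (\<lambda>x. f x * g x)"
  using integrable_scaleR_bounded[OF assms] by (simp add: mult.commute)

lemma integrable_lebesgue_on_compact:
  fixes f :: "'a::euclidean_space \<Rightarrow> 'b::euclidean_space"
  assumes "compact K" "continuous_on K f"
  shows "integrable (lebesgue_on K) f"
proof -
  have "integrable lborel (\<lambda>x. indicator K x *\<^sub>R f x)"
    using assms by (rule borel_integrable_compact)
  then have "integrable lebesgue (\<lambda>x. indicator K x *\<^sub>R f x)"
    by (subst integrable_completion) auto
  then show ?thesis
    by (subst integrable_restrict_space)
      (use assms in \<open>auto intro!: lmeasurable_compact[THEN fmeasurableD]\<close>)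
qed

lemma L1_loc_continuous: "continuous_on \<Omega> f \<Longrightarrow> L1_loc \<Omega> f"
  by (auto simp: L1_loc_def intro: integrable_lebesgue_on_compact continuous_on_subset)

text \<open>Local integrability says nothing about v on all of \<Omega>. But the product is the
  extension by zero of its restriction to K, where v is integrable and \<phi> is bounded.\<close>

lemma integrable_L1_loc_mult:
  fixes v \<phi> :: "real^'n::finite \<Rightarrow> real"
  assumes v: "L1_loc \<Omega> v" and K: "compact K" "K \<subseteq> \<Omega>" and \<Omega>: "\<Omega> \<in> sets lebesgue"
    and \<phi>: "continuous_on K \<phi>" "\<And>x. x \<in> \<Omega> - K \<Longrightarrow> \<phi> x = 0"
  shows "integrable (lebesgue_on \<Omega>) (\<lambda>x. v x * \<phi> x)"
proof -
  have Kl: "K \<in> sets lebesgue"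
    using K by (auto intro!: lmeasurable_compact[THEN fmeasurableD])
  obtain B where B: "\<And>x. x \<in> K \<Longrightarrow> \<bar>\<phi> x\<bar> \<le> B"
    using compact_imp_bounded[OF compact_continuous_image[OF \<phi>(1) K(1)]]
    by (auto simp: bounded_iff)
  have "integrable (lebesgue_on K) (\<lambda>x. v x * \<phi> x)"
    using v K \<phi>(1) Kl B
    by (intro integrable_mult_bounded[where B = B] continuous_imp_measurable_on_sets_lebesgue)
      (auto simp: L1_loc_def intro!: AE_I2)
  then have "integrable lebesgue (\<lambda>x. if x \<in> K then v x * \<phi> x else 0)"
    using Kl by (simp add: Lebesgue_Measure.integrable_restrict_UNIV)
  also have "(\<lambda>x. if x \<in> K then v x * \<phi> x else 0) = (\<lambda>x. if x \<in> \<Omega> then v x * \<phi> x else 0)"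
    using \<phi>(2) K(2) by (auto simp: fun_eq_iff)
  finally show ?thesis
    using \<Omega> by (simp add: Lebesgue_Measure.integrable_restrict_UNIV)
qed

section \<open>Partial derivatives of compactly supported functions have integral zero\<close>

lemma integral_lborel_translate:
  fixes f :: "'a::euclidean_space \<Rightarrow> real"
  assumes "f \<in> borel_measurable borel"
  shows "(LINT x|lborel. f (x + a)) = integral\<^sup>L lborel f"
  using integral_distr[of "(+) a" lborel borel f] assms by (simp add: lborel_distr_plus add.commute)

text \<open>The difference quotients of f have integral zero by translation invariance and converge
  pointwise to the partial derivative. The mean value theorem bounds them by B, so dominated
  convergence applies; measurability comes from the same limit.\<close>

lemma integral_lborel_partial_deriv:
  fixes f :: "real^'n::finite \<Rightarrow> real"
  assumes diff: "\<And>x. f differentiable (at x)" and bd: "\<And>x. \<bar>partial_deriv i f x\<bar> \<le> B"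
    and K: "compact K" "\<And>x. x \<notin> K \<Longrightarrow> f x = 0"
  shows "partial_deriv i f \<in> borel_measurable borel" "integral\<^sup>L lborel (partial_deriv i f) = 0"
proof -
  have cont: "continuous_on UNIV f"
    using diff by (auto intro!: differentiable_imp_continuous_on differentiable_at_imp_differentiable_on)
  then have [measurable]: "f \<in> borel_measurable borel"
    by (rule borel_measurable_continuous_onI)
  obtain R where R: "K \<subseteq> cball 0 R"
    using bounded_subset_ballD[OF compact_imp_bounded[OF K(1)], of 0] by (auto dest: subset_trans[OF _ ball_subset_cball])
  define h where "h n = inverse (real (Suc n))" for n
  have h: "0 < h n" "h n \<le> 1" for n by (simp_all add: h_def inverse_eq_divide)
  define q where "q n x = (f (x + h n *\<^sub>R axis i 1) - f x) / h n" for n x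
  have [measurable]: "q n \<in> borel_measurable borel" for n
    unfolding q_def by measurable
  have deriv: "((\<lambda>s. f (x + s *\<^sub>R axis i 1)) has_real_derivative partial_deriv i f (x + t *\<^sub>R axis i 1)) (at t)" for x t
    by (rule has_real_derivative_line[OF diff])
  have lim: "(\<lambda>n. q n x) \<longlonglongrightarrow> partial_deriv i f x" for x
  proof -
    have "((\<lambda>s. (f (x + s *\<^sub>R axis i 1) - f x) / s) \<longlongrightarrow> partial_deriv i f x) (at 0)"
      using deriv[of x 0] by (simp add: has_field_derivative_iff)
    moreover have "filterlim h (at 0) sequentially"
      unfolding filterlim_at
    proof
      show "h \<longlonglongrightarrow> 0" unfolding h_def by (rule LIMSEQ_inverse_real_of_nat)
      show "\<forall>\<^sub>F n in sequentially. h n \<in> UNIV \<and> h n \<noteq> 0"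
        by (simp add: h_def)
    qed
    ultimately show ?thesis
      unfolding q_def by (rule filterlim_compose)
  qed
  show meas: "partial_deriv i f \<in> borel_measurable borel"
    by (rule borel_measurable_LIMSEQ_real[OF lim]) simp
  \<comment> \<open>Steps have length at most 1, so beyond radius \<open>R + 1\<close> both sample
    points of the quotient lie outside K.\<close>
  have bound: "\<bar>q n x\<bar> \<le> B * indicator (cball 0 (R + 1)) x" for n x
  proof (cases "x \<in> cball 0 (R + 1)")
    case True
    obtain s where "f (x + h n *\<^sub>R axis i 1) - f (x + 0 *\<^sub>R axis i 1) = (h n - 0) * partial_deriv i f (x + s *\<^sub>R axis i 1)"
      using MVT2[OF h(1) deriv] by blast
    then have "q n x = partial_deriv i f (x + s *\<^sub>R axis i 1)"
      using h(1)[of n] by (simp add: q_def)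
    with bd True show ?thesis by simp
  next
    case False
    have "norm x \<le> norm (x + h n *\<^sub>R axis i 1) + norm (h n *\<^sub>R axis i (1::real))"
      using norm_triangle_ineq4[of "x + h n *\<^sub>R axis i 1" "h n *\<^sub>R axis i 1"] by simp
    with False h[of n] have "x \<notin> cball 0 R" "x + h n *\<^sub>R axis i 1 \<notin> cball 0 R"
      by auto
    then have "f x = 0" "f (x + h n *\<^sub>R axis i 1) = 0" using R K(2) by blast+
    with False show ?thesis by (simp add: q_def)
  qed
  have int: "integrable lborel f"
  proof -
    have "integrable lborel (\<lambda>x. indicator K x *\<^sub>R f x)"
      using K(1) by (rule borel_integrable_compact) (rule continuous_on_subset[OF cont], simp)
    also have "(\<lambda>x. indicator K x *\<^sub>R f x) = f"
      using K(2) by (auto simp: indicator_def fun_eq_iff)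
    finally show ?thesis .
  qed
  have int': "integrable lborel (\<lambda>x. f (x + a))" for a
    using integrable_distr[of "(+) a" lborel borel f] int by (simp add: lborel_distr_plus add.commute)
  have "integral\<^sup>L lborel (q n) = 0" for n
    unfolding q_def using int int' by (simp add: integral_lborel_translate)
  moreover have "(\<lambda>n. integral\<^sup>L lborel (q n)) \<longlonglongrightarrow> integral\<^sup>L lborel (partial_deriv i f)"
  proof (rule integral_dominated_convergence)
    show "integrable lborel (\<lambda>x::real^'n. B * indicator (cball 0 (R + 1)) x)"
      using borel_integrable_compact[of "cball (0::real^'n) (R+1)" "\<lambda>x. B"] by (simp add: mult.commute)
  qed (use meas lim bound in auto)
  ultimately show "integral\<^sup>L lborel (partial_deriv i f) = 0"
    by (simp add: LIMSEQ_const_iff)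
qed

text \<open>The extension of f by zero is differentiable on the whole space: \<Omega> and the
  complement of K are open and cover it, and on the latter the extension vanishes.\<close>

lemma integral_partial_deriv_compact_support:
  fixes f :: "real^'n::finite \<Rightarrow> real"
  assumes \<Omega>: "open \<Omega>" and K: "compact K" "K \<subseteq> \<Omega>" and f: "Ck_on (Suc 0) f \<Omega>"
    and f0: "\<And>x. x \<in> \<Omega> - K \<Longrightarrow> f x = 0"
  shows "(LINT x|lebesgue_on \<Omega>. partial_deriv i f x) = 0"
proof -
  define g where "g x = (if x \<in> \<Omega> then f x else 0)" for x
  have g0: "g x = 0" if "x \<in> - K" for x using f0 that by (auto simp: g_def)
  have cK: "open (- K)" using K(1) by (intro open_Compl compact_imp_closed)
  have pd: "partial_deriv i g x = (if x \<in> \<Omega> then partial_deriv i f x else 0)" for x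
    using partial_deriv_cong[OF \<Omega>, of x g f i] partial_deriv_cong[OF cK, of x g "\<lambda>x. 0" i] g0 K(2)
    by (auto simp: g_def)
  have diff: "g differentiable (at x)" for x
  proof (cases "x \<in> \<Omega>")
    case True
    then show ?thesis
      using differentiable_cong_open[OF \<Omega>, of x g f] f by (simp add: g_def)
  next
    case False
    then show ?thesis
      using differentiable_cong_open[OF cK, of x g "\<lambda>x. 0"] g0 K(2) by auto
  qed
  have "continuous_on K (partial_deriv i f)"
    using f K(2) by (auto intro: continuous_on_subset)
  then obtain B where B: "\<And>x. x \<in> K \<Longrightarrow> \<bar>partial_deriv i f x\<bar> \<le> B"
    using compact_imp_bounded[OF compact_continuous_image[OF _ K(1)]]
    by (fastforce simp: bounded_iff)
  \<comment> \<open>The maximum with 0 covers the points outside K, and an empty K, for which B is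
    arbitrary.\<close>
  have bd: "\<bar>partial_deriv i g x\<bar> \<le> max B 0" for x
  proof (cases "x \<in> K")
    case True
    then show ?thesis using B[of x] K(2) by (auto simp: pd)
  next
    case False
    then have "partial_deriv i g x = 0"
      using partial_deriv_cong[OF cK, of x g "\<lambda>x. 0" i] g0 by simp
    then show ?thesis by simp
  qed
  note * = integral_lborel_partial_deriv[of g i, OF diff bd K(1) g0[simplified]]
  have "(LINT x|lebesgue_on \<Omega>. partial_deriv i f x) = integral\<^sup>L lebesgue (partial_deriv i g)"
    unfolding pd using \<Omega> by (subst Lebesgue_Measure.integral_restrict_UNIV) auto
  also have "\<dots> = 0"
    using * by (simp add: integral_completion)
  finally show ?thesis .
qed

lemma integral_by_parts_compact_support:
  fixes f \<phi> :: "real^'n::finite \<Rightarrow> real"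
  assumes \<Omega>: "open \<Omega>" and K: "compact K" "K \<subseteq> \<Omega>" and f: "Ck_on (Suc 0) f \<Omega>"
    and \<phi>: "Ck_on (Suc 0) \<phi> UNIV" and \<phi>0: "\<And>x. x \<notin> K \<Longrightarrow> \<phi> x = 0"
  shows "integrable (lebesgue_on \<Omega>) (\<lambda>x. f x * partial_deriv i \<phi> x)"
    "integrable (lebesgue_on \<Omega>) (\<lambda>x. partial_deriv i f x * \<phi> x)"
    "(LINT x|lebesgue_on \<Omega>. f x * partial_deriv i \<phi> x) = - (LINT x|lebesgue_on \<Omega>. partial_deriv i f x * \<phi> x)"
proof -
  have \<Omega>l: "\<Omega> \<in> sets lebesgue" using \<Omega> by simp
  have pd0: "partial_deriv i \<phi> x = 0" if "x \<notin> K" for x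
    using partial_deriv_cong[of "- K" x \<phi> "\<lambda>x. 0" i] K(1) \<phi>0 that by (simp add: compact_imp_closed open_Compl)
  have c\<phi>: "continuous_on K \<phi>" "continuous_on K (partial_deriv i \<phi>)"
    using \<phi> Ck_on_continuous_on[OF \<phi>] by (auto intro: continuous_on_subset)
  show 1: "integrable (lebesgue_on \<Omega>) (\<lambda>x. f x * partial_deriv i \<phi> x)"
    using L1_loc_continuous[OF Ck_on_continuous_on[OF f]] K \<Omega>l c\<phi>(2)
    by (rule integrable_L1_loc_mult) (simp add: pd0)
  have "continuous_on \<Omega> (partial_deriv i f)" using f by simp
  from L1_loc_continuous[OF this] K \<Omega>l c\<phi>(1)
  show 2: "integrable (lebesgue_on \<Omega>) (\<lambda>x. partial_deriv i f x * \<phi> x)"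
    by (rule integrable_L1_loc_mult) (simp add: \<phi>0)
  have "0 = (LINT x|lebesgue_on \<Omega>. partial_deriv i (\<lambda>x. f x * \<phi> x) x)"
    using \<phi>0 by (intro integral_partial_deriv_compact_support[symmetric, OF \<Omega> K]
        Ck_on_mult[OF \<Omega> f Ck_on_subset[OF \<phi>]]) auto
  also have "\<dots> = (LINT x|lebesgue_on \<Omega>. f x * partial_deriv i \<phi> x + partial_deriv i f x * \<phi> x)"
    using f \<phi> by (intro Bochner_Integration.integral_cong refl partial_deriv_mult) auto
  also have "\<dots> = (LINT x|lebesgue_on \<Omega>. f x * partial_deriv i \<phi> x) + (LINT x|lebesgue_on \<Omega>. partial_deriv i f x * \<phi> x)"
    using 1 2 by simp
  finally show "(LINT x|lebesgue_on \<Omega>. f x * partial_deriv i \<phi> x) = - (LINT x|lebesgue_on \<Omega>. partial_deriv i f x * \<phi> x)"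
    by simp
qed

lemma test_funE:
  assumes "test_fun \<Omega> \<phi>"
  obtains K where "compact K" "K \<subseteq> \<Omega>" "\<And>x. x \<notin> K \<Longrightarrow> \<phi> x = 0" "\<And>x i. x \<notin> K \<Longrightarrow> partial_deriv i \<phi> x = 0"
    "\<And>k. Ck_on k \<phi> UNIV"
proof
  let ?K = "closure {x. \<phi> x \<noteq> 0}"
  show "compact ?K" "?K \<subseteq> \<Omega>" "\<And>k. Ck_on k \<phi> UNIV" using assms by (auto simp: test_fun_def)
  show 0: "\<phi> x = 0" if "x \<notin> ?K" for x
    using that closure_subset[of "{x. \<phi> x \<noteq> 0}"] by auto
  show "partial_deriv i \<phi> x = 0" if "x \<notin> ?K" for x i
  proof -
    have "partial_deriv i \<phi> x = partial_deriv i (\<lambda>x. 0) x"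
    proof (rule partial_deriv_cong)
      show "open (- ?K)" by (rule open_Compl[OF closed_closure])
      show "x \<in> - ?K" using that by (simp only: Compl_iff not_False_eq_True)
      show "\<phi> y = 0" if "y \<in> - ?K" for y using 0 ComplD[OF that] by blast
    qed
    then show ?thesis by simp
  qed
qed

lemma L1_loc_L_infty:
  assumes "open \<Omega>" "L_infty \<Omega> H"
  shows "L1_loc \<Omega> H"
  unfolding L1_loc_def
proof (intro allI impI, elim conjE)
  fix K assume K: "compact K" "K \<subseteq> \<Omega>"
  have Kl: "K \<in> lmeasurable" using K(1) by (rule lmeasurable_compact)
  obtain C where H: "H \<in> borel_measurable (lebesgue_on \<Omega>)" and C: "AE x in lebesgue_on \<Omega>. \<bar>H x\<bar> \<le> C"
    using assms(2) by (auto simp: L_infty_def)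
  have "AE x in lebesgue. x \<in> \<Omega> \<longrightarrow> \<bar>H x\<bar> \<le> C"
    using C assms(1) by (simp add: AE_restrict_space_iff)
  then have "AE x in lebesgue. x \<in> K \<longrightarrow> \<bar>H x\<bar> \<le> C"
    by eventually_elim (use K(2) in auto)
  then have "AE x in lebesgue_on K. \<bar>H x\<bar> \<le> C"
    using fmeasurableD[OF Kl] by (simp add: AE_restrict_space_iff)
  moreover have "integrable (lebesgue_on K) (\<lambda>x. 1 :: real)"
    using K(1) by (intro integrable_lebesgue_on_compact continuous_on_const)
  ultimately have "integrable (lebesgue_on K) (\<lambda>x. 1 * H x)"
    by (intro integrable_mult_bounded measurable_restrict_mono[OF H K(2)])
  then show "integrable (lebesgue_on K) H" by simp
qed

lemma indicator_lebesgue_on: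
  assumes S: "S \<in> sets lebesgue" and A: "A \<in> lmeasurable" "A \<subseteq> S"
  shows "integrable (lebesgue_on S) (indicator A :: 'a::euclidean_space \<Rightarrow> real)"
    and "integral\<^sup>L (lebesgue_on S) (indicator A) = measure lebesgue A"
proof -
  have S': "S \<inter> space lebesgue \<in> sets lebesgue" using S by simp
  have "A \<in> sets (lebesgue_on S)"
    using fmeasurableD[OF A(1)] A(2) by (simp add: sets_restrict_space_iff[OF S'])
  moreover have "emeasure (lebesgue_on S) A < \<infinity>"
    unfolding emeasure_restrict_space[OF S' A(2)] using fmeasurableD2[OF A(1)] by (simp only: less_top infinity_ennreal_def)
  ultimately show "integrable (lebesgue_on S) (indicator A :: 'a \<Rightarrow> real)"
    by (rule integrable_real_indicator)
  have "integral\<^sup>L (lebesgue_on S) (indicator A) = measure (lebesgue_on S) (A \<inter> space (lebesgue_on S))"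
    by (rule Bochner_Integration.integral_indicator)
  also have "\<dots> = measure (lebesgue_on S) A" using A(2) by (simp only: space_lebesgue_on Int_absorb2)
  also have "\<dots> = measure lebesgue A" by (rule measure_restrict_space[OF S' A(2)])
  finally show "integral\<^sup>L (lebesgue_on S) (indicator A) = measure lebesgue A" .
qed

subsection \<open>Uniqueness of weak gradients\<close>

text \<open>This family is closed under differentiation up to linear combinations.\<close>

definition flat_bump :: "nat \<Rightarrow> real \<Rightarrow> real" where
  "flat_bump m t = (if t > 0 then (1 / t) ^ m * exp (- (1 / t)) else 0)"

text \<open>The substitution y = 1 / t turns the limit from the right into the decay of
  \<open>y ^ m / exp y\<close> at infinity.\<close>

lemma flat_bump_tendsto_0: "(flat_bump m \<longlongrightarrow> 0) (at 0)"
proof -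
  have "((\<lambda>y::real. y ^ m / exp y) \<longlongrightarrow> 0) at_top"
    by (rule tendsto_power_div_exp_0)
  then have "((\<lambda>t::real. (inverse t) ^ m / exp (inverse t)) \<longlongrightarrow> 0) (at_right 0)"
    by (rule filterlim_compose[OF _ filterlim_inverse_at_top_right])
  then have "(flat_bump m \<longlongrightarrow> 0) (at_right 0)"
    by (rule Lim_transform_eventually)
      (auto simp: eventually_at_filter flat_bump_def exp_minus field_simps)
  moreover have "(flat_bump m \<longlongrightarrow> 0) (at_left 0)"
    by (rule tendsto_eventually) (auto simp: eventually_at_filter flat_bump_def)
  ultimately show ?thesis
    by (simp add: filterlim_at_split)
qed

lemma flat_bump_derivative:
  "(flat_bump m has_real_derivative (flat_bump (m + 2) t - real m * flat_bump (m + 1) t)) (at t)"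
proof -
  consider "t < 0" | "t = 0" | "t > 0" by linarith
  then show ?thesis
  proof cases
    case 1
    have "((\<lambda>t. 0) has_real_derivative (flat_bump (m + 2) t - real m * flat_bump (m + 1) t)) (at t)"
      using 1 by (simp add: flat_bump_def)
    then show ?thesis
      by (rule has_field_derivative_transform_within_open[where S = "{..<0}"])
        (use 1 in \<open>auto simp: flat_bump_def\<close>)
  next
    case 2
    \<comment> \<open>At 0 the difference quotient is \<open>flat_bump (Suc m)\<close>, so the
      previous limit, one index higher, gives derivative 0.\<close>
    have "((\<lambda>t. flat_bump m t / t) \<longlongrightarrow> 0) (at 0)"
      using flat_bump_tendsto_0[of "Suc m"]
      by (rule Lim_transform_eventually) (auto simp: flat_bump_def field_simps)
    with 2 show ?thesis
      by (simp add: has_field_derivative_iff flat_bump_def[of _ 0])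
  next
    case 3
    have "((\<lambda>t. (1 / t) ^ m * exp (- (1 / t))) has_real_derivative
        (flat_bump (m + 2) t - real m * flat_bump (m + 1) t)) (at t)"
    proof -
      have d: "((\<lambda>t. 1 / t) has_real_derivative - ((1 / t)\<^sup>2)) (at t)"
        using 3 by (auto intro!: derivative_eq_intros simp: power2_eq_square)
      have A: "((\<lambda>t. (1 / t) ^ m * exp (- (1 / t))) has_real_derivative
        (1 / t) ^ m * (exp (- (1 / t)) * (- (- ((1 / t)\<^sup>2)))) +
        real m * (- ((1 / t)\<^sup>2) * (1 / t) ^ (m - Suc 0)) * exp (- (1 / t))) (at t)"
        by (intro DERIV_mult' DERIV_fun_exp DERIV_minus DERIV_power d)
      \<comment> \<open>For m = 0 the truncated exponent \<open>m - Suc 0\<close> is harmless, since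
        the factor \<open>real m\<close> is 0.\<close>
      have e: "real m * (- ((1 / t)\<^sup>2) * (1 / t) ^ (m - Suc 0)) = - (real m * (1 / t) ^ (m + 1))"
        by (cases m) (simp_all add: power2_eq_square del: of_nat_Suc)
      show ?thesis
        by (rule DERIV_cong[OF A], unfold e) (use 3 in \<open>simp add: flat_bump_def power2_eq_square algebra_simps\<close>)
    qed
    then show ?thesis
      by (rule has_field_derivative_transform_within_open[where S = "{0<..}"])
        (use 3 in \<open>auto simp: flat_bump_def\<close>)
  qed
qed

text \<open>Differentiation leads to the indices m + 1 and m + 2, so the induction on k keeps m
  arbitrary. The affine argument, with s = 1 and s = -1, serves the two faces of a box orthogonal to
  axis i.\<close>

lemma Ck_on_flat_bump:
  fixes i :: "'n::finite"
  shows "Ck_on k (\<lambda>x::real^'n. flat_bump m (s * x $ i + c)) UNIV"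
proof (induction k arbitrary: m)
  case 0
  have "continuous_on UNIV (flat_bump m)"
    by (rule DERIV_continuous_on) (rule has_field_derivative_at_within[OF flat_bump_derivative])
  then have "continuous_on UNIV (\<lambda>x::real^'n. flat_bump m (s * x $ i + c))"
    by (rule continuous_on_compose2) (auto intro!: continuous_intros)
  then show ?case by simp
next
  case (Suc k)
  define f where "f = (\<lambda>x::real^'n. s * x $ i + c)"
  have f: "(f has_derivative (\<lambda>h. s * h $ i)) (at x)" for x
    unfolding f_def by (auto intro!: derivative_eq_intros bounded_linear.has_derivative[OF bounded_linear_vec_nth])
  then have fd: "f differentiable (at x)" for x by (auto simp: differentiable_def)
  have fp: "partial_deriv j f x = (if i = j then s else 0)" for x j
    using partial_deriv_eqI[OF f] by (simp add: axis_def)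
  have "partial_deriv j (\<lambda>x. flat_bump m (f x)) =
      (\<lambda>x. (flat_bump (m + 2) (f x) - real m * flat_bump (m + 1) (f x)) * (if i = j then s else 0))" for j
    using partial_deriv_compose[OF fd flat_bump_derivative] by (auto simp: fp)
  moreover have "(\<lambda>x. flat_bump m (f x)) differentiable (at x)" for x
    by (rule differentiable_compose_real[OF fd flat_bump_derivative])
  ultimately show ?case
    using Suc by (auto simp: f_def intro!: Ck_on_mult Ck_on_diff)
qed

text \<open>A product over all coordinates of two one-sided bumps, one for each face. Each factor
  lies in [0, 1] and is positive exactly on the inner side of its face.\<close>

lemma box_bump_exists:
  fixes a b :: "real^'n::finite"
  shows "\<exists>\<beta>. (\<forall>k. Ck_on k \<beta> UNIV) \<and> (\<forall>x. (x \<in> box a b \<longrightarrow> 0 < \<beta> x) \<and> (x \<notin> box a b \<longrightarrow> \<beta> x = 0) \<and>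
    0 \<le> \<beta> x \<and> \<beta> x \<le> 1)"
proof -
  define \<beta> where "\<beta> x = (\<Prod>i\<in>UNIV. flat_bump 0 (1 * x $ i + (- a $ i)) * flat_bump 0 ((-1) * x $ i + b $ i))" for x :: "real^'n"
  have fb: "0 \<le> flat_bump 0 t" "flat_bump 0 t \<le> 1" "0 < flat_bump 0 t \<longleftrightarrow> 0 < t" "flat_bump 0 t = 0 \<longleftrightarrow> t \<le> 0" for t
    by (auto simp: flat_bump_def)
  have 1: "Ck_on k \<beta> UNIV" for k
    unfolding \<beta>_def by (intro Ck_on_prod Ck_on_mult Ck_on_flat_bump open_UNIV)
  have 2: "0 \<le> \<beta> x" for x unfolding \<beta>_def by (intro prod_nonneg) (simp add: fb)
  have 3: "\<beta> x \<le> 1" for x unfolding \<beta>_def by (intro prod_le_1) (simp add: fb mult_le_one)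
  have 4: "0 < \<beta> x" if "x \<in> box a b" for x
    unfolding \<beta>_def using that by (intro prod_pos) (simp add: fb mem_box_cart)
  have 5: "\<beta> x = 0" if "x \<notin> box a b" for x
    unfolding \<beta>_def using that by (auto simp: fb mem_box_cart not_less)
  show ?thesis using 1 2 3 4 5 by blast
qed

text \<open>The test functions \<open>1 - (1 - \<beta>)\<^sup>n\<close> converge boundedly to the indicator of the box.\<close>

lemma set_integral_box_eq_0:
  fixes v :: "real^'n::finite \<Rightarrow> real"
  assumes "open \<Omega>" "L1_loc \<Omega> v" and v: "\<And>\<phi>. test_fun \<Omega> \<phi> \<Longrightarrow> (LINT x|lebesgue_on \<Omega>. v x * \<phi> x) = 0"
    and ab: "cbox a b \<subseteq> \<Omega>"
  shows "integrable lebesgue (\<lambda>x. indicator (box a b) x * v x)"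
    "(LINT x|lebesgue. indicator (box a b) x * v x) = 0"
proof -
  obtain \<beta> where \<beta>: "\<And>k. Ck_on k \<beta> UNIV" "\<And>x. x \<in> box a b \<Longrightarrow> 0 < \<beta> x" "\<And>x. x \<notin> box a b \<Longrightarrow> \<beta> x = 0"
    "\<And>x. 0 \<le> \<beta> x" "\<And>x. \<beta> x \<le> 1"
    using box_bump_exists[of a b] by metis
  have "integrable (lebesgue_on (cbox a b)) v"
    using assms(2) ab by (simp add: L1_loc_def)
  then have "integrable lebesgue (\<lambda>x. if x \<in> cbox a b then v x else 0)"
    by (simp add: Lebesgue_Measure.integrable_restrict_UNIV)
  from integrable_mult_indicator[OF _ this, of "box a b"]
  show int: "integrable lebesgue (\<lambda>x. indicator (box a b) x * v x)"
    by (rule Bochner_Integration.integrable_cong[THEN iffD1, OF refl, rotated])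
      (use box_subset_cbox[of a b] in \<open>auto simp: indicator_def\<close>)
  define \<psi> where "\<psi> n x = 1 - (1 - \<beta> x) ^ n" for n x
  have \<psi>0: "\<psi> n x = 0" if "x \<notin> box a b" for n x
    using \<beta>(3)[OF that] by (simp add: \<psi>_def)
  have c\<psi>: "Ck_on k (\<psi> n) UNIV" for k n
    unfolding \<psi>_def by (intro Ck_on_diff Ck_on_power Ck_on_const \<beta> open_UNIV)
  have test: "test_fun \<Omega> (\<psi> n)" for n
  proof -
    \<comment> \<open>The support may reach the boundary of the box, which is why the closed box is
      assumed to lie in \<Omega>.\<close>
    have "closure {x. \<psi> n x \<noteq> 0} \<subseteq> cbox a b"
      using \<psi>0 box_subset_cbox[of a b] by (intro closure_minimal closed_cbox) blast
    moreover from this have "compact (closure {x. \<psi> n x \<noteq> 0})"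
      by (meson bounded_cbox bounded_subset closed_closure compact_eq_bounded_closed)
    ultimately show ?thesis using ab c\<psi> by (auto simp: test_fun_def)
  qed
  have "(LINT x|lebesgue. indicator (box a b) x * v x * \<psi> n x) = 0" for n
  proof -
    have "(LINT x|lebesgue. indicator (box a b) x * v x * \<psi> n x) =
       (LINT x|lebesgue. (if x \<in> \<Omega> then v x * \<psi> n x else 0))"
      using ab box_subset_cbox[of a b] \<psi>0
      by (intro Bochner_Integration.integral_cong refl) (auto simp: indicator_def)
    also have "\<dots> = 0"
      using v[OF test] assms(1) by (simp add: Lebesgue_Measure.integral_restrict_UNIV)
    finally show ?thesis .
  qed
  moreover have "(\<lambda>n. LINT x|lebesgue. indicator (box a b) x * v x * \<psi> n x) \<longlonglongrightarrow>
      (LINT x|lebesgue. indicator (box a b) x * v x)"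
  proof (rule integral_dominated_convergence)
    show "integrable lebesgue (\<lambda>x. \<bar>indicator (box a b) x * v x\<bar>)" using int by simp
    show "(\<lambda>x. indicator (box a b) x * v x) \<in> borel_measurable lebesgue" using int by simp
    have "\<psi> n \<in> borel_measurable borel" for n
      using Ck_on_continuous_on[OF c\<psi>] by (rule borel_measurable_continuous_onI)
    then have "\<psi> n \<in> borel_measurable lebesgue" for n
      by (simp add: measurable_completion)
    then show "(\<lambda>x. indicator (box a b) x * v x * \<psi> n x) \<in> borel_measurable lebesgue" for n
      using borel_measurable_integrable[OF int] by simp
    have "(\<lambda>n. indicator (box a b) x * v x * \<psi> n x) \<longlonglongrightarrow> indicator (box a b) x * v x" for x
    proof (cases "x \<in> box a b")
      case True
      have "(\<lambda>n. (1 - \<beta> x) ^ n) \<longlonglongrightarrow> 0"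
        using \<beta>(2)[OF True] \<beta>(5)[of x] by (intro LIMSEQ_power_zero) simp
      then have "(\<lambda>n. v x * \<psi> n x) \<longlonglongrightarrow> v x * (1 - 0)"
        unfolding \<psi>_def by (intro tendsto_mult tendsto_diff tendsto_const)
      with True show ?thesis by simp
    qed auto
    then show "AE x in lebesgue. (\<lambda>n. indicator (box a b) x * v x * \<psi> n x) \<longlonglongrightarrow> indicator (box a b) x * v x"
      by simp
    have "\<bar>\<psi> n x\<bar> \<le> 1" for n x
      using \<beta>(4,5)[of x] power_le_one[of "1 - \<beta> x" n] by (simp add: \<psi>_def)
    then have "norm (indicator (box a b) x * v x * \<psi> n x) \<le> \<bar>indicator (box a b) x * v x\<bar>" for n x
      by (simp add: abs_mult mult_left_le)
    then show "AE x in lebesgue. norm (indicator (box a b) x * v x * \<psi> n x) \<le> \<bar>indicator (box a b) x * v x\<bar>" for n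
      by simp
  qed
  ultimately show "(LINT x|lebesgue. indicator (box a b) x * v x) = 0"
    by (simp add: LIMSEQ_const_iff)
qed

section \<open>The fundamental lemma of the calculus of variations\<close>

text \<open>A Dynkin system argument: boxes form an intersection-stable generator of the Borel sets,
  and vanishing of the integral passes to complements and disjoint countable unions. Complements use
  that the total integral is 0. Since boxes generate only the Borel sets, w is first replaced by a
  Borel representative.\<close>

lemma AE_eq_0_if_box_integrals_eq_0:
  fixes w :: "'a::euclidean_space \<Rightarrow> real"
  assumes w: "integrable lebesgue w"
    and box: "\<And>a b. (LINT x|lebesgue. indicator (box a b) x * w x) = 0"
    and UNIV: "integral\<^sup>L lebesgue w = 0"
  shows "AE x in lebesgue. w x = 0"
proof -
  obtain w' where w'[measurable]: "w' \<in> borel_measurable lborel" and ae: "AE x in lborel. w x = w' x"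
    using completion_ex_borel_measurable_real[OF borel_measurable_integrable[OF w]] by blast
  have ae': "AE x in lebesgue. w x = w' x"
    using ae by (rule AE_completion)
  have w'l: "w' \<in> borel_measurable lebesgue" using w' by (rule measurable_completion)
  have "integrable lebesgue w'"
    using w w'l ae' by (subst integrable_cong_AE[symmetric]) auto
  then have int: "integrable lborel w'" using w' by (simp add: integrable_completion)
  have si: "set_integrable lborel A w'" if "A \<in> sets borel" for A
    unfolding set_integrable_def using that by (intro integrable_mult_indicator int) simp
  have eq: "set_lebesgue_integral lborel A w' = (LINT x|lebesgue. indicator A x * w x)" if "A \<in> sets borel" for A
  proof -
    have [measurable]: "A \<in> sets lborel" "A \<in> sets lebesgue" using that by auto
    have "set_lebesgue_integral lborel A w' = (LINT x|lebesgue. indicator A x * w' x)"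
      unfolding set_lebesgue_integral_def by (subst integral_completion) auto
    also have "\<dots> = (LINT x|lebesgue. indicator A x * w x)"
      using ae' w'l borel_measurable_integrable[OF w] by (intro integral_cong_AE) auto
    finally show ?thesis .
  qed
  have "set_lebesgue_integral lborel A w' = 0" if "A \<in> sets borel" for A
  proof -
    have 1: "A \<in> sigma_sets UNIV (range (\<lambda>(a::'a, b). box a b))"
      using that by (simp add: borel_eq_box sets_measure_of case_prod_unfold)
    have 2: "Int_stable (range (\<lambda>(a::'a, b). box a b))"
      by (auto simp: Int_stable_def box_Int_box)
    have 3: "range (\<lambda>(a::'a, b). box a b) \<subseteq> Pow UNIV" by simp
    from 2 3 1 show ?thesis
    proof (induction rule: sigma_sets_induct_disjoint)
      case (compl A)
      then have A: "A \<in> sets borel"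
        by (simp add: borel_eq_box sets_measure_of case_prod_unfold)
      have "set_lebesgue_integral lborel (UNIV - A) w' + set_lebesgue_integral lborel A w' = set_lebesgue_integral lborel UNIV w'"
      proof -
        have "(UNIV - A) \<inter> A = {}" by blast
        from set_integral_Un[OF this si si] A show ?thesis by simp
      qed
      also have "\<dots> = 0"
        using eq[of UNIV] UNIV by simp
      finally show ?case using compl by simp
    next
      case (union A)
      then have A: "A i \<in> sets borel" for i
        by (auto simp: borel_eq_box sets_measure_of case_prod_unfold)
      have "set_lebesgue_integral lborel (\<Union>i. A i) w' = (\<Sum>i. set_lebesgue_integral lborel (A i) w')"
        using A union(1)
        by (intro lebesgue_integral_countable_add si) (auto simp: disjoint_family_on_def)
      then show ?case using union by simp
    qed (use box eq in \<open>auto simp: set_lebesgue_integral_def\<close>)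
  qed
  from sigma_finite_measure.density_zero[OF sigma_finite_lborel int] this have "AE x in lborel. w' x = 0" by simp
  then have "AE x in lebesgue. w' x = 0" by (rule AE_completion)
  with ae' show ?thesis by eventually_elim simp
qed

text \<open>Countably many closed boxes exhaust \<Omega>. On each of them v is cut off to the open
  box and becomes globally integrable; the boundary of the box is a null set.\<close>

lemma fundamental_lemma_calculus_of_variations:
  fixes v :: "real^'n::finite \<Rightarrow> real"
  assumes \<Omega>: "open \<Omega>" and "L1_loc \<Omega> v"
    and "\<And>\<phi>. test_fun \<Omega> \<phi> \<Longrightarrow> (LINT x|lebesgue_on \<Omega>. v x * \<phi> x) = 0"
  shows "AE x in lebesgue_on \<Omega>. v x = 0"
proof -
  obtain D where D: "countable D" "\<And>X. X \<in> D \<Longrightarrow> X \<subseteq> \<Omega> \<and> (\<exists>a b. X = cbox a b)" "\<Union>D = \<Omega>"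
    using open_countable_Union_open_cbox[OF \<Omega>] by (metis PowD subsetD)
  have "AE x in lebesgue. x \<in> X \<longrightarrow> v x = 0" if XD: "X \<in> D" for X
  proof -
    obtain a b where X: "X = cbox a b" "cbox a b \<subseteq> \<Omega>" using D(2)[OF XD] by auto
    define w where "w x = indicator (box a b) x * v x" for x
    have "AE x in lebesgue. w x = 0"
    proof (rule AE_eq_0_if_box_integrals_eq_0)
      show "integrable lebesgue w" "integral\<^sup>L lebesgue w = 0"
        unfolding w_def using set_integral_box_eq_0[OF assms X(2)] by auto
      fix c d
      \<comment> \<open>Intersections of boxes are boxes, and the closed intersection still lies in
        \<Omega>, so integrals of the cut-off function over boxes are again of the kind already
        known to vanish.\<close>
      obtain p q where pq: "box a b \<inter> box c d = box p q" "cbox a b \<inter> cbox c d = cbox p q"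
        using box_Int_box Int_interval by blast
      have "(LINT x|lebesgue. indicator (box c d) x * w x) = (LINT x|lebesgue. indicator (box p q) x * v x)"
        unfolding pq(1)[symmetric] w_def
        by (intro Bochner_Integration.integral_cong refl) (auto simp: indicator_def)
      also have "\<dots> = 0"
        using pq(2) X(2) by (intro set_integral_box_eq_0(2)[OF assms]) auto
      finally show "(LINT x|lebesgue. indicator (box c d) x * w x) = 0" .
    qed
    moreover have "AE x in lebesgue. x \<notin> cbox a b - box a b"
      using negligible_frontier_interval[of a b, unfolded negligible_iff_null_sets] by (rule AE_not_in)
    ultimately show ?thesis
      by eventually_elim (auto simp: w_def X indicator_def split: if_splits)
  qed
  then have "AE x in lebesgue. \<forall>X\<in>D. x \<in> X \<longrightarrow> v x = 0"
    using D(1) by (rule AE_ball_countable')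
  then have "AE x in lebesgue. x \<in> \<Omega> \<longrightarrow> v x = 0"
    by eventually_elim (use D(3) in auto)
  then show ?thesis using \<Omega> by (simp add: AE_restrict_space_iff)
qed

text \<open>Only f is assumed measurable; g inherits measurability because Lebesgue measure is
  complete. This suits integrands built from a chosen weak gradient, known through an almost
  everywhere identity.\<close>

lemma integral_lebesgue_on_AE:
  fixes f g :: "'a::euclidean_space \<Rightarrow> 'b::euclidean_space"
  assumes S: "S \<in> sets lebesgue" and f: "f \<in> borel_measurable (lebesgue_on S)"
    and ae: "AE x in lebesgue_on S. f x = g x"
  shows "integral\<^sup>L (lebesgue_on S) f = integral\<^sup>L (lebesgue_on S) g"
proof -
  let ?f = "\<lambda>x. if x \<in> S then f x else 0" and ?g = "\<lambda>x. if x \<in> S then g x else 0"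
  have "?f \<in> borel_measurable lebesgue" using f S by (simp only: borel_measurable_if)
  moreover have "AE x in lebesgue. ?f x = ?g x"
    using ae S by (simp add: AE_restrict_space_iff)
  ultimately have "?g \<in> borel_measurable lebesgue" by (rule borel_measurable_AE)
  then have g: "g \<in> borel_measurable (lebesgue_on S)" using S by (simp only: borel_measurable_if)
  show "integral\<^sup>L (lebesgue_on S) f = integral\<^sup>L (lebesgue_on S) g"
    by (rule integral_cong_AE[OF f g ae])
qed

section \<open>Weak gradients: the C^1 case, linearity, uniqueness\<close>

lemma has_weak_grad_C1:
  assumes \<Omega>: "open \<Omega>" and u: "Ck_on (Suc 0) u \<Omega>"
  shows "has_weak_grad \<Omega> u (grad u)"
  unfolding has_weak_grad_def
proof (intro conjI allI impI)
  show "L1_loc \<Omega> u" by (rule L1_loc_continuous[OF Ck_on_continuous_on[OF u]])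
  show "L1_loc \<Omega> (grad u)"
    unfolding grad_def using u by (intro L1_loc_continuous continuous_on_vec_lambda) auto
  fix \<phi> :: "real^'a \<Rightarrow> real" and i
  assume "test_fun \<Omega> \<phi>"
  then obtain K where K: "compact K" "K \<subseteq> \<Omega>" "\<And>x. x \<notin> K \<Longrightarrow> \<phi> x = 0" "\<And>k. Ck_on k \<phi> UNIV"
    by (rule test_funE) blast
  show "(LINT x|lebesgue_on \<Omega>. u x * partial_deriv i \<phi> x) = - (LINT x|lebesgue_on \<Omega>. grad u x $ i * \<phi> x)"
    unfolding grad_nth by (rule integral_by_parts_compact_support(3)[OF \<Omega> K(1,2) u K(4,3)])
qed

lemma L1_loc_nth: "L1_loc \<Omega> G \<Longrightarrow> L1_loc \<Omega> (\<lambda>x. G x $ i)"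
  by (auto simp: L1_loc_def intro: integrable_bounded_linear[OF bounded_linear_vec_nth])

lemma L1_loc_add_scaleR:
  "L1_loc \<Omega> f \<Longrightarrow> L1_loc \<Omega> g \<Longrightarrow> L1_loc \<Omega> (\<lambda>x. f x + c *\<^sub>R g x)"
  by (auto simp: L1_loc_def)

text \<open>The scalar c lets one statement serve sums (c = 1, for competitors u + \<phi>) and
  differences (c = -1, for uniqueness and for approximation by test functions).\<close>

lemma has_weak_grad_add_scaleR:
  assumes \<Omega>: "open \<Omega>" and u: "has_weak_grad \<Omega> u G" and v: "has_weak_grad \<Omega> v G'"
  shows "has_weak_grad \<Omega> (\<lambda>x. u x + c * v x) (\<lambda>x. G x + c *\<^sub>R G' x)"
  unfolding has_weak_grad_def
proof (intro conjI allI impI)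
  note l = u[unfolded has_weak_grad_def, THEN conjunct1] v[unfolded has_weak_grad_def, THEN conjunct1]
  note lG = u[unfolded has_weak_grad_def, THEN conjunct2, THEN conjunct1] v[unfolded has_weak_grad_def, THEN conjunct2, THEN conjunct1]
  show "L1_loc \<Omega> (\<lambda>x. u x + c * v x)" using L1_loc_add_scaleR[OF l, of c] by simp
  show "L1_loc \<Omega> (\<lambda>x. G x + c *\<^sub>R G' x)" by (rule L1_loc_add_scaleR[OF lG])
  fix \<phi> :: "real^'a \<Rightarrow> real" and i
  assume t: "test_fun \<Omega> \<phi>"
  then obtain K where K: "compact K" "K \<subseteq> \<Omega>" "\<And>x. x \<notin> K \<Longrightarrow> \<phi> x = 0" "\<And>x i. x \<notin> K \<Longrightarrow> partial_deriv i \<phi> x = 0"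
    "\<And>k. Ck_on k \<phi> UNIV"
    by (rule test_funE) blast
  have \<Omega>s: "\<Omega> \<in> sets lebesgue" using \<Omega> by simp
  have c: "continuous_on K \<phi>" "continuous_on K (partial_deriv i \<phi>)"
    using Ck_on_continuous_on[OF K(5)] K(5)[of "Suc 0"] by (auto intro: continuous_on_subset)
  have i1: "integrable (lebesgue_on \<Omega>) (\<lambda>x. w x * \<phi> x)" if "L1_loc \<Omega> w" for w
    using that K(1,2) \<Omega>s c(1) by (rule integrable_L1_loc_mult) (use K(3) in auto)
  have i2: "integrable (lebesgue_on \<Omega>) (\<lambda>x. w x * partial_deriv i \<phi> x)" if "L1_loc \<Omega> w" for w
    using that K(1,2) \<Omega>s c(2) by (rule integrable_L1_loc_mult) (use K(4) in auto)
  have eq: "(LINT x|lebesgue_on \<Omega>. u x * partial_deriv i \<phi> x) = - (LINT x|lebesgue_on \<Omega>. G x $ i * \<phi> x)"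
    "(LINT x|lebesgue_on \<Omega>. v x * partial_deriv i \<phi> x) = - (LINT x|lebesgue_on \<Omega>. G' x $ i * \<phi> x)"
    using u v t by (simp_all add: has_weak_grad_def)
  have "(LINT x|lebesgue_on \<Omega>. (u x + c * v x) * partial_deriv i \<phi> x) =
      (LINT x|lebesgue_on \<Omega>. u x * partial_deriv i \<phi> x) + c * (LINT x|lebesgue_on \<Omega>. v x * partial_deriv i \<phi> x)"
    using i2[OF l(1)] i2[OF l(2)] by (simp add: distrib_right mult.assoc)
  also have "\<dots> = - ((LINT x|lebesgue_on \<Omega>. G x $ i * \<phi> x) + c * (LINT x|lebesgue_on \<Omega>. G' x $ i * \<phi> x))"
    unfolding eq by simp
  also have "\<dots> = - (LINT x|lebesgue_on \<Omega>. (G x + c *\<^sub>R G' x) $ i * \<phi> x)"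
    using i1[OF L1_loc_nth[OF lG(1)]] i1[OF L1_loc_nth[OF lG(2)]] by (simp add: distrib_right mult.assoc)
  finally show "(LINT x|lebesgue_on \<Omega>. (u x + c * v x) * partial_deriv i \<phi> x) =
      - (LINT x|lebesgue_on \<Omega>. (G x + c *\<^sub>R G' x) $ i * \<phi> x)" .
qed

text \<open>The difference of two weak gradients is a weak gradient of 0, so each of its components
  integrates to 0 against every test function.\<close>

lemma has_weak_grad_unique:
  assumes \<Omega>: "open \<Omega>" and u: "has_weak_grad \<Omega> u G" "has_weak_grad \<Omega> u G'"
  shows "AE x in lebesgue_on \<Omega>. G x = G' x"
proof -
  have w: "has_weak_grad \<Omega> (\<lambda>x. 0) (\<lambda>x. G x + (-1) *\<^sub>R G' x)"
    using has_weak_grad_add_scaleR[OF \<Omega> u, of "-1"] by simp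
  have "AE x in lebesgue_on \<Omega>. (G x + (-1) *\<^sub>R G' x) $ i = 0" for i
  proof (rule fundamental_lemma_calculus_of_variations[OF \<Omega>])
    show "L1_loc \<Omega> (\<lambda>x. (G x + (-1) *\<^sub>R G' x) $ i)"
      using w unfolding has_weak_grad_def by (intro L1_loc_nth) blast
    show "(LINT x|lebesgue_on \<Omega>. (G x + (-1) *\<^sub>R G' x) $ i * \<phi> x) = 0" if "test_fun \<Omega> \<phi>" for \<phi>
      using w that unfolding has_weak_grad_def by simp
  qed
  then have "AE x in lebesgue_on \<Omega>. \<forall>i. (G x + (-1) *\<^sub>R G' x) $ i = 0"
    by (subst AE_all_countable) simp
  then show ?thesis by eventually_elim (simp add: vec_eq_iff)
qed

lemma AE_weak_grad_eq:
  assumes "open \<Omega>" "has_weak_grad \<Omega> u G"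
  shows "AE x in lebesgue_on \<Omega>. weak_grad \<Omega> u x = G x"
  using has_weak_grad_unique[OF assms(1) _ assms(2)] someI[of "has_weak_grad \<Omega> u" G] assms(2)
  unfolding weak_grad_def by blast

lemma has_weak_grad_weak_grad:
  "weakly_differentiable \<Omega> u \<Longrightarrow> has_weak_grad \<Omega> u (weak_grad \<Omega> u)"
  unfolding weakly_differentiable_def weak_grad_def by (erule someI_ex)

subsection \<open>Measure of sublevel sets\<close>

text \<open>The \<open>N\<^sup>2\<close> translates of \<open>E\<close> by grid vectors \<open>i d a + j d b\<close>, \<open>i, j < N = \<lceil>1 / d\<rceil>\<close>,
  are pairwise disjoint and lie in a fixed ball.\<close>

lemma measure_le_if_plane_sections_small:
  fixes E :: "'a::euclidean_space set"
  assumes E: "E \<in> lmeasurable" "E \<subseteq> cball p r" and d: "0 < d" and ab: "norm a \<le> 1" "norm b \<le> 1"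
    and sep: "\<And>x y s t. \<lbrakk>x \<in> E; y \<in> E; y - x = s *\<^sub>R a + t *\<^sub>R b\<rbrakk> \<Longrightarrow> \<bar>s\<bar> < d \<and> \<bar>t\<bar> < d"
  shows "measure lebesgue E \<le> d\<^sup>2 * measure lebesgue (cball p (r + 2))"
proof -
  \<comment> \<open>Rounding up gives at least \<open>(1 / d)\<^sup>2\<close> translates, while N -
    1 < 1 / d keeps every shift \<open>i * d\<close> with i < N below 1.\<close>
  define N where "N = nat \<lceil>1 / d\<rceil>"
  have N: "1 / d \<le> real N" "real N < 1 / d + 1" "0 < N"
    using d by (auto simp: N_def) linarith+
  define v where "v = (\<lambda>(i, j). (real i * d) *\<^sub>R a + (real j * d) *\<^sub>R b)"
  define I where "I = {..<N} \<times> {..<N}"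
  have small: "real i * d < 1" if "i < N" for i
  proof -
    have "real i \<le> real N - 1" using that by linarith
    also have "\<dots> < 1 / d" using N by simp
    finally show ?thesis using d by (simp add: field_simps)
  qed
  have disj: "disjoint_family_on (\<lambda>k. (+) (v k) ` E) I"
    unfolding disjoint_family_on_def
  proof (intro ballI impI)
    fix k l assume kl: "k \<in> I" "l \<in> I" "k \<noteq> l"
    obtain i j i' j' where k: "k = (i, j)" and l: "l = (i', j')" by fastforce
    show "(+) (v k) ` E \<inter> (+) (v l) ` E = {}"
    proof (rule ccontr)
      assume "(+) (v k) ` E \<inter> (+) (v l) ` E \<noteq> {}"
      then obtain x y where xy: "x \<in> E" "y \<in> E" "v k + x = v l + y" by auto
      then have "y - x = v k - v l" by (simp add: algebra_simps)
      also have "\<dots> = ((real i - real i') * d) *\<^sub>R a + ((real j - real j') * d) *\<^sub>R b"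
        by (simp add: v_def k l algebra_simps)
      finally have "\<bar>(real i - real i') * d\<bar> < d" "\<bar>(real j - real j') * d\<bar> < d"
        using sep[OF xy(1,2)] by auto
      then have "\<bar>real i - real i'\<bar> < 1" "\<bar>real j - real j'\<bar> < 1"
        using d by (auto simp: abs_mult)
      then have "i = i'" "j = j'" by linarith+
      with kl k l show False by simp
    qed
  qed
  have sub: "(\<Union>k\<in>I. (+) (v k) ` E) \<subseteq> cball p (r + 2)"
  proof clarify
    fix i j x assume ij: "(i, j) \<in> I" and x: "x \<in> E"
    have "norm (v (i, j)) \<le> norm ((real i * d) *\<^sub>R a) + norm ((real j * d) *\<^sub>R b)"
      unfolding v_def prod.case by (rule norm_triangle_ineq)
    also have "\<dots> \<le> 1 * 1 + 1 * 1"
      unfolding norm_scaleR using small[of i] small[of j] ij ab d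
      by (intro add_mono mult_mono) (auto simp: I_def abs_mult)
    finally have "norm (v (i, j)) \<le> 2" by simp
    moreover have "dist p (v (i, j) + x) \<le> dist p x + norm (v (i, j))"
      using dist_triangle[of p "v (i, j) + x" x] by (simp add: dist_norm)
    ultimately show "v (i, j) + x \<in> cball p (r + 2)" using E(2) x by auto
  qed
  have tr: "(+) (v k) ` E \<in> lmeasurable" "measure lebesgue ((+) (v k) ` E) = measure lebesgue E" for k
    using E(1) by (auto simp: measurable_translation measure_translation)
  have "real (N * N) * measure lebesgue E = (\<Sum>k\<in>I. measure lebesgue ((+) (v k) ` E))"
    by (simp add: tr I_def)
  also have "\<dots> = measure lebesgue (\<Union>k\<in>I. (+) (v k) ` E)"
    using disj fmeasurableD2[OF tr(1)] fmeasurableD[OF tr(1)]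
    by (intro measure_finite_Union[symmetric]) (auto simp only: I_def infinity_ennreal_def intro!: finite_cartesian_product finite_lessThan)
  also have "\<dots> \<le> measure lebesgue (cball p (r + 2))"
    using sub tr by (intro measure_mono_fmeasurable) (auto simp: I_def fmeasurableD)
  finally have *: "real (N * N) * measure lebesgue E \<le> measure lebesgue (cball p (r + 2))" .
  have "measure lebesgue E = d\<^sup>2 * ((1 / d) * (1 / d) * measure lebesgue E)"
    using d by (simp add: power2_eq_square)
  also have "\<dots> \<le> d\<^sup>2 * (real (N * N) * measure lebesgue E)"
    unfolding of_nat_mult using N d by (intro mult_left_mono mult_right_mono mult_mono) auto
  also have "\<dots> \<le> d\<^sup>2 * measure lebesgue (cball p (r + 2))"
    by (rule mult_left_mono[OF *]) simp
  finally show ?thesis .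
qed

text \<open>If all \<open>2 \<times> 2\<close> minors of \<open>A\<close> vanish, \<open>A\<close> is of the form \<open>a b\<^sup>T\<close>, so the skew part of \<open>A\<close> has
  its range in the span of \<open>a\<close> and \<open>b\<close>.\<close>

lemma nonzero_minor_if_rank_skew_gt_2:
  fixes A :: "real^'n^'n"
  assumes "rank (\<chi> i j. A $ i $ j - A $ j $ i) > 2"
  shows "\<exists>i j k l. A $ i $ k * A $ j $ l - A $ i $ l * A $ j $ k \<noteq> 0"
proof (rule ccontr)
  assume "\<nexists>i j k l. A $ i $ k * A $ j $ l - A $ i $ l * A $ j $ k \<noteq> 0"
  then have minor: "A $ i $ k * A $ j $ l = A $ i $ l * A $ j $ k" for i j k l by auto
  obtain a b where ab: "\<And>i j. A $ i $ j = a i * b j"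
  proof (cases "\<exists>i k. A $ i $ k \<noteq> 0")
    case True
    then obtain i k where "A $ i $ k \<noteq> 0" by blast
    \<comment> \<open>A nonzero entry serves as pivot: a is column k and b is row i divided by the
      pivot.\<close>
    then have "A $ j $ l = (A $ j $ k) * (A $ i $ l / A $ i $ k)" for j l
      using minor[of i k j l] by (simp add: field_simps)
    then show thesis by (rule that)
  next
    case False
    then show thesis by (intro that[of "\<lambda>_. 0" "\<lambda>_. 0"]) auto
  qed
  let ?M = "\<chi> i j. A $ i $ j - A $ j $ i"
  have "?M *v v \<in> span {(\<chi> i. a i), (\<chi> i. b i)}" for v :: "real^'n"
  proof -
    have "?M *v v = (\<Sum>j\<in>UNIV. b j * v $ j) *\<^sub>R (\<chi> i. a i) - (\<Sum>j\<in>UNIV. a j * v $ j) *\<^sub>R (\<chi> i. b i)"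
    proof (rule vec_eq_iff[THEN iffD2], rule allI)
      fix i
      have "(?M *v v) $ i = (\<Sum>j\<in>UNIV. (b j * v $ j) * a i - (a j * v $ j) * b i)"
        by (auto simp: matrix_vector_mult_def ab algebra_simps intro!: sum.cong)
      then show "(?M *v v) $ i = ((\<Sum>j\<in>UNIV. b j * v $ j) *\<^sub>R (\<chi> i. a i) - (\<Sum>j\<in>UNIV. a j * v $ j) *\<^sub>R (\<chi> i. b i)) $ i"
        by (simp add: sum_subtractf sum_distrib_right)
    qed
    then show ?thesis by (simp add: span_base span_diff span_scale)
  qed
  then have "range ((*v) ?M) \<subseteq> span {(\<chi> i. a i), (\<chi> i. b i)}" by auto
  then have "dim (range ((*v) ?M)) \<le> card {(\<chi> i. a i), (\<chi> i. b i)}"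
    by (intro dim_le_card) auto
  also have "\<dots> \<le> 2" by (simp add: card_insert_if)
  finally show False using assms by (simp add: rank_dim_range)
qed

text \<open>Cramer's rule for the rows i and j: s and t times the minor are combinations of two
  components of the vector on the right, and these are bounded by its norm.\<close>

lemma minor_coercive:
  fixes A :: "real^'n^'n"
  assumes "A $ i $ k * A $ j $ l - A $ i $ l * A $ j $ k \<noteq> 0"
  shows "\<exists>c>0. \<forall>s t. c * (\<bar>s\<bar> + \<bar>t\<bar>) \<le> norm (s *\<^sub>R column k A + t *\<^sub>R column l A)"
proof -
  define m where "m = A $ i $ k * A $ j $ l - A $ i $ l * A $ j $ k"
  \<comment> \<open>B dominates the coefficients in both instances of Cramer's rule together; the
    summand 1 makes it visibly positive.\<close>
  define B where "B = \<bar>A $ j $ l\<bar> + \<bar>A $ i $ l\<bar> + \<bar>A $ j $ k\<bar> + \<bar>A $ i $ k\<bar> + 1"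
  have B: "B > 0" by (auto simp: B_def)
  have "\<bar>m\<bar> / B * (\<bar>s\<bar> + \<bar>t\<bar>) \<le> norm (s *\<^sub>R column k A + t *\<^sub>R column l A)" for s t
  proof -
    define v where "v = s *\<^sub>R column k A + t *\<^sub>R column l A"
    have vi: "v $ i = s * A $ i $ k + t * A $ i $ l" "v $ j = s * A $ j $ k + t * A $ j $ l"
      by (simp_all add: v_def column_def)
    have le: "\<bar>x * v $ i - y * v $ j\<bar> \<le> (\<bar>x\<bar> + \<bar>y\<bar>) * norm v" for x y
    proof -
      have "\<bar>x * v $ i - y * v $ j\<bar> \<le> \<bar>x\<bar> * \<bar>v $ i\<bar> + \<bar>y\<bar> * \<bar>v $ j\<bar>"
        using abs_triangle_ineq4[of "x * v $ i" "y * v $ j"] by (simp add: abs_mult)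
      also have "\<dots> \<le> \<bar>x\<bar> * norm v + \<bar>y\<bar> * norm v"
        by (intro add_mono mult_left_mono component_le_norm_cart) auto
      finally show ?thesis by (simp add: distrib_right)
    qed
    have "s * m = A $ j $ l * v $ i - A $ i $ l * v $ j" "t * m = A $ i $ k * v $ j - A $ j $ k * v $ i"
      by (simp_all add: m_def vi algebra_simps)
    then have "\<bar>s\<bar> * \<bar>m\<bar> \<le> (\<bar>A $ j $ l\<bar> + \<bar>A $ i $ l\<bar>) * norm v"
      "\<bar>t\<bar> * \<bar>m\<bar> \<le> (\<bar>A $ j $ k\<bar> + \<bar>A $ i $ k\<bar>) * norm v"
      using le[of "A $ j $ l" "A $ i $ l"] le[of "- (A $ j $ k)" "- (A $ i $ k)"]
      by (simp_all add: abs_mult[symmetric] algebra_simps)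
    then have "\<bar>m\<bar> * (\<bar>s\<bar> + \<bar>t\<bar>) \<le> (B - 1) * norm v"
      by (simp add: B_def algebra_simps)
    also have "\<dots> \<le> B * norm v" by (simp add: mult_right_mono)
    finally show ?thesis using B by (simp add: v_def field_simps)
  qed
  moreover have "\<bar>m\<bar> / B > 0" using B assms by (simp add: m_def)
  ultimately show ?thesis by blast
qed

definition jac :: "(real^'n::finite \<Rightarrow> real^'n) \<Rightarrow> real^'n \<Rightarrow> real^'n^'n" where
  "jac G x = (\<chi> i j. partial_deriv j (\<lambda>y. G y $ i) x)"

lemma has_derivative_jac:
  assumes "\<And>i. (\<lambda>y. G y $ i) differentiable (at x)"
  shows "(G has_derivative (*v) (jac G x)) (at x)"
proof -
  have "((\<lambda>y. G y $ i) has_derivative (\<lambda>h. (jac G x *v h) $ i)) (at x)" for i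
    using has_derivative_grad[OF assms, of i]
    by (simp add: jac_def matrix_vector_mult_def inner_vec_def)
  then show ?thesis
    by (subst has_derivative_componentwise_within) (auto simp: Basis_vec_def inner_axis)
qed

lemma norm_matrix_vector_mult_le:
  fixes M :: "real^'n^'m"
  shows "norm (M *v h) \<le> real CARD('m) * norm M * norm h"
proof -
  have "norm (M *v h) \<le> (\<Sum>i\<in>UNIV. \<bar>(M *v h) $ i\<bar>)" by (rule norm_le_l1_cart)
  also have "\<dots> \<le> (\<Sum>i\<in>(UNIV::'m set). norm M * norm h)"
  proof (rule sum_mono)
    fix i
    have "(M *v h) $ i = M $ i \<bullet> h" by (simp add: matrix_vector_mult_def inner_vec_def)
    also have "\<bar>\<dots>\<bar> \<le> norm (M $ i) * norm h" by (rule Cauchy_Schwarz_ineq2)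
    also have "\<dots> \<le> norm M * norm h"
      by (intro mult_right_mono Finite_Cartesian_Product.norm_nth_le) auto
    finally show "\<bar>(M *v h) $ i\<bar> \<le> norm M * norm h" .
  qed
  finally show ?thesis by simp
qed

lemma compact_sublevel_norm:
  fixes G :: "'a::t2_space \<Rightarrow> 'b::real_normed_vector"
  assumes "compact K" "continuous_on K G"
  shows "compact {x \<in> K. norm (G x) \<le> \<delta>}"
proof -
  have "closed (K \<inter> (\<lambda>x. norm (G x)) -` {..\<delta>})"
    using assms by (intro continuous_closed_preimage continuous_on_norm) (auto simp: compact_imp_closed)
  moreover have "{x \<in> K. norm (G x) \<le> \<delta>} = K \<inter> (K \<inter> (\<lambda>x. norm (G x)) -` {..\<delta>})" by auto
  ultimately show ?thesis using assms(1) by (metis compact_Int_closed)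
qed

section \<open>Quadratic measure bounds near the zeros of a vector field\<close>

text \<open>A nonzero minor makes two columns of \<open>jac G p\<close> coercive with constant c.
  Where the Jacobian stays within c / 4 of \<open>jac G p\<close>, the mean value inequality
  preserves 3 c / 4 along planes parallel to the two axes. Points of the sublevel set in such a
  plane are then O(\<delta>) apart, and the packing lemma applies.\<close>

lemma sublevel_measure_local:
  fixes G :: "real^'n::finite \<Rightarrow> real^'n"
  assumes \<Omega>: "open \<Omega>" "p \<in> \<Omega>" and G: "\<And>i. Ck_on (Suc 0) (\<lambda>x. G x $ i) \<Omega>"
    and rank: "rank (\<chi> i j. jac G p $ i $ j - jac G p $ j $ i) > 2"
  shows "\<exists>r>0. \<exists>C\<ge>0. cball p r \<subseteq> \<Omega> \<and> (\<forall>\<delta>>0. measure lebesgue {x \<in> cball p r. norm (G x) \<le> \<delta>} \<le> C * \<delta>\<^sup>2)"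
proof -
  obtain i j k l where "jac G p $ i $ k * jac G p $ j $ l - jac G p $ i $ l * jac G p $ j $ k \<noteq> 0"
    using nonzero_minor_if_rank_skew_gt_2[OF rank] by blast
  from minor_coercive[OF this] obtain c where c: "c > 0"
    "\<And>s t. c * (\<bar>s\<bar> + \<bar>t\<bar>) \<le> norm (s *\<^sub>R column k (jac G p) + t *\<^sub>R column l (jac G p))"
    by blast
  have deriv: "(G has_derivative (*v) (jac G x)) (at x)" if "x \<in> \<Omega>" for x
    using G that by (intro has_derivative_jac) auto
  \<comment> \<open>The dimension cancels the factor in \<open>norm_matrix_vector_mult_le\<close>,
    so that the operator norm of the difference is at most c / 4.\<close>
  define \<kappa> where "\<kappa> = c / 4 / real CARD('n)"
  have "\<kappa> > 0" using c by (simp add: \<kappa>_def)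
  have "continuous_on \<Omega> (jac G)"
    unfolding jac_def using G by (intro continuous_on_vec_lambda) auto
  then have "isCont (jac G) p"
    using \<Omega> by (auto simp: continuous_on_eq_continuous_at)
  then obtain r1 where r1: "r1 > 0" "\<And>x. dist x p < r1 \<Longrightarrow> dist (jac G x) (jac G p) < \<kappa>"
    using \<open>\<kappa> > 0\<close> unfolding continuous_at_eps_delta by blast
  obtain r2 where r2: "r2 > 0" "cball p r2 \<subseteq> \<Omega>"
    using \<Omega> open_contains_cball by blast
  define r where "r = min (r1 / 2) r2"
  have r: "r > 0" "cball p r \<subseteq> \<Omega>" "r < r1"
    using r1(1) r2 by (auto simp: r_def)
  have onorm: "onorm (\<lambda>h. jac G x *v h - jac G p *v h) \<le> c / 4" if "x \<in> cball p r" for x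
  proof (rule onorm_le)
    fix h
    have "norm (jac G x *v h - jac G p *v h) \<le> real CARD('n) * norm (jac G x - jac G p) * norm h"
      using norm_matrix_vector_mult_le[of "jac G x - jac G p" h]
      by (simp add: matrix_vector_mult_diff_rdistrib)
    also have "\<dots> \<le> real CARD('n) * \<kappa> * norm h"
      using r1(2)[of x] that r(3)
      by (intro mult_right_mono mult_left_mono) (auto simp: dist_commute dist_norm norm_minus_commute)
    finally show "norm (jac G x *v h - jac G p *v h) \<le> c / 4 * norm h"
      by (simp add: \<kappa>_def)
  qed
  have lower: "3 * c / 4 * (\<bar>s\<bar> + \<bar>t\<bar>) \<le> norm (G y - G x)"
    if xy: "x \<in> cball p r" "y \<in> cball p r" "y - x = s *\<^sub>R axis k 1 + t *\<^sub>R axis l 1" for x y s t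
  proof -
    have n: "norm (y - x) \<le> \<bar>s\<bar> + \<bar>t\<bar>"
      unfolding xy(3) using norm_triangle_ineq[of "s *\<^sub>R axis k (1::real)" "t *\<^sub>R axis l 1"] by simp
    \<comment> \<open>The linearisation is taken at the centre p and not at x, because coercivity of
      the columns is known only at p.\<close>
    have "norm (G y - G x - jac G p *v (y - x)) \<le> norm (y - x) * (c / 4)"
    proof (rule differentiable_bound_linearization[where S = "cball p r" and f' = "\<lambda>x. (*v) (jac G x)" and ?x0.0 = p])
      show "x + \<tau> *\<^sub>R (y - x) \<in> cball p r" if "\<tau> \<in> {0..1}" for \<tau>
      proof -
        have "(1 - \<tau>) *\<^sub>R x + \<tau> *\<^sub>R y = x + \<tau> *\<^sub>R (y - x)"
          by (simp add: scaleR_diff_right scaleR_left_diff_distrib)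
        then show ?thesis using convexD_alt[OF convex_cball xy(1,2), of \<tau>] that by simp
      qed
      show "(G has_derivative (*v) (jac G z)) (at z within cball p r)" if "z \<in> cball p r" for z
        by (rule has_derivative_at_withinI[OF deriv[OF subsetD[OF r(2) that]]])
      show "onorm ((\<lambda>h. jac G z *v h) - (\<lambda>h. jac G p *v h)) \<le> c / 4" if "z \<in> cball p r" for z
        using onorm[OF that] by (simp add: fun_diff_def)
      show "p \<in> cball p r" using r(1) by simp
    qed
    also have "\<dots> \<le> (\<bar>s\<bar> + \<bar>t\<bar>) * (c / 4)"
      using n c(1) by (intro mult_right_mono) auto
    finally have a: "norm (jac G p *v (y - x)) - (\<bar>s\<bar> + \<bar>t\<bar>) * (c / 4) \<le> norm (G y - G x)"
      using norm_triangle_ineq2[of "jac G p *v (y - x)" "G y - G x"]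
      by (simp only: norm_minus_commute[of "jac G p *v (y - x)"])
    have b: "jac G p *v (y - x) = s *\<^sub>R column k (jac G p) + t *\<^sub>R column l (jac G p)"
      by (simp add: xy(3) matrix_vector_right_distrib matrix_vector_mult_scaleR matrix_vector_mult_basis)
    have "c * (\<bar>s\<bar> + \<bar>t\<bar>) - (\<bar>s\<bar> + \<bar>t\<bar>) * (c / 4) \<le> norm (G y - G x)"
      using a c(2)[of s t] unfolding b by linarith
    then show ?thesis by (simp add: field_simps)
  qed
  define C where "C = (3 / c)\<^sup>2 * measure lebesgue (cball p (r + 2))"
  have "measure lebesgue {x \<in> cball p r. norm (G x) \<le> \<delta>} \<le> C * \<delta>\<^sup>2" if "\<delta> > 0" for \<delta>
  proof -
    let ?E = "{x \<in> cball p r. norm (G x) \<le> \<delta>}"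
    have "continuous_on (cball p r) G"
      using deriv r(2) by (intro continuous_at_imp_continuous_on) (auto intro: has_derivative_continuous)
    then have "compact ?E" by (intro compact_sublevel_norm) simp
    then have "?E \<in> lmeasurable" by (rule lmeasurable_compact)
    then have "measure lebesgue ?E \<le> (3 * \<delta> / c)\<^sup>2 * measure lebesgue (cball p (r + 2))"
    proof (rule measure_le_if_plane_sections_small)
      fix x y s t
      assume xy: "x \<in> ?E" "y \<in> ?E" "y - x = s *\<^sub>R axis k 1 + t *\<^sub>R axis l 1"
      have "3 * c / 4 * (\<bar>s\<bar> + \<bar>t\<bar>) \<le> norm (G y) + norm (G x)"
        using lower[of x y s t] xy norm_triangle_ineq4[of "G y" "G x"] by auto
      also have "\<dots> \<le> 2 * \<delta>" using xy by auto
      \<comment> \<open>The packing lemma asks for strict bounds. Relaxing 2 to 9 / 4 provides one,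
        and 9 / 4 divided by 3 c / 4 is the 3 / c in d.\<close>
      also have "\<dots> < 9 / 4 * \<delta>" using that by simp
      finally have "\<bar>s\<bar> + \<bar>t\<bar> < 3 * \<delta> / c" using c(1) by (simp add: field_simps)
      then show "\<bar>s\<bar> < 3 * \<delta> / c \<and> \<bar>t\<bar> < 3 * \<delta> / c" by linarith
    qed (use that c(1) in auto)
    also have "\<dots> = C * \<delta>\<^sup>2" by (simp add: C_def power_mult_distrib power_divide)
    finally show ?thesis .
  qed
  moreover have "C \<ge> 0" by (simp add: C_def)
  ultimately show ?thesis using r by blast
qed

lemma C1_on_vec_continuous_on:
  fixes G :: "real^'n::finite \<Rightarrow> real^'m::finite"
  assumes "\<And>i. Ck_on k (\<lambda>x. G x $ i) \<Omega>"
  shows "continuous_on \<Omega> G"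
  using continuous_on_vec_lambda[of \<Omega> "\<lambda>i x. G x $ i"] Ck_on_continuous_on[OF assms] by simp

text \<open>Finitely many of the balls from the local bound cover K, and their constants add
  up.\<close>

lemma sublevel_measure_compact:
  fixes G :: "real^'n::finite \<Rightarrow> real^'n"
  assumes \<Omega>: "open \<Omega>" and G: "\<And>i. Ck_on (Suc 0) (\<lambda>x. G x $ i) \<Omega>"
    and rank: "\<And>p. p \<in> \<Omega> \<Longrightarrow> rank (\<chi> i j. jac G p $ i $ j - jac G p $ j $ i) > 2"
    and K: "compact K" "K \<subseteq> \<Omega>"
  shows "\<exists>C\<ge>0. \<forall>\<delta>>0. measure lebesgue {x \<in> K. norm (G x) \<le> \<delta>} \<le> C * \<delta>\<^sup>2"
proof -
  define P where "P p r C \<longleftrightarrow> r > 0 \<and> C \<ge> 0 \<and> cball p r \<subseteq> \<Omega> \<and>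
      (\<forall>\<delta>>0. measure lebesgue {x \<in> cball p r. norm (G x) \<le> \<delta>} \<le> C * \<delta>\<^sup>2)" for p and r C :: real
  have "\<forall>p\<in>K. \<exists>f. P p (fst f) (snd f)"
  proof
    fix p assume "p \<in> K"
    then have "p \<in> \<Omega>" using K(2) by blast
    from sublevel_measure_local[OF \<Omega> this G rank[OF this]] obtain r C where "P p r C"
      unfolding P_def by blast
    then show "\<exists>f. P p (fst f) (snd f)" by (intro exI[of _ "(r, C)"]) simp
  qed
  then obtain f where f: "\<forall>p\<in>K. P p (fst (f p)) (snd (f p))"
    using bchoice[of K "\<lambda>p f. P p (fst f) (snd f)"] by blast
  define r C where "r p = fst (f p)" and "C p = snd (f p)" for p
  have rC: "\<And>p. p \<in> K \<Longrightarrow> r p > 0" "\<And>p. p \<in> K \<Longrightarrow> C p \<ge> 0" "\<And>p. p \<in> K \<Longrightarrow> cball p (r p) \<subseteq> \<Omega>"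
    "\<And>p \<delta>. p \<in> K \<Longrightarrow> \<delta> > 0 \<Longrightarrow> measure lebesgue {x \<in> cball p (r p). norm (G x) \<le> \<delta>} \<le> C p * \<delta>\<^sup>2"
    using f unfolding P_def r_def C_def by blast+
  have "K \<subseteq> (\<Union>p\<in>K. ball p (r p))" using rC(1) by force
  moreover have "open (ball p (r p))" for p by simp
  ultimately obtain T where T: "T \<subseteq> K" "finite T" "K \<subseteq> (\<Union>p\<in>T. ball p (r p))"
    using compactE_image[OF K(1), of K "\<lambda>p. ball p (r p)"] by metis
  note cont = continuous_on_subset[OF C1_on_vec_continuous_on[OF G]]
  have "measure lebesgue {x \<in> K. norm (G x) \<le> \<delta>} \<le> (\<Sum>p\<in>T. C p) * \<delta>\<^sup>2" if "\<delta> > 0" for \<delta>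
  proof -
    let ?E = "\<lambda>p. {x \<in> cball p (r p). norm (G x) \<le> \<delta>}"
    have E: "?E p \<in> lmeasurable" if "p \<in> T" for p
      using rC(3) that T(1) by (intro lmeasurable_compact compact_sublevel_norm cont) auto
    have "measure lebesgue {x \<in> K. norm (G x) \<le> \<delta>} \<le> measure lebesgue (\<Union>p\<in>T. ?E p)"
    proof (rule measure_mono_fmeasurable)
      show "{x \<in> K. norm (G x) \<le> \<delta>} \<subseteq> (\<Union>p\<in>T. ?E p)"
        using T(3) by (force simp: less_imp_le)
      show "{x \<in> K. norm (G x) \<le> \<delta>} \<in> sets lebesgue"
        using K by (intro fmeasurableD lmeasurable_compact compact_sublevel_norm cont) auto
      show "(\<Union>p\<in>T. ?E p) \<in> lmeasurable" using T(2) E by (intro fmeasurable.finite_UN) auto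
    qed
    also have "\<dots> \<le> (\<Sum>p\<in>T. measure lebesgue (?E p))"
      using T(2) E by (intro measure_UNION_le fmeasurableD)
    also have "\<dots> \<le> (\<Sum>p\<in>T. C p * \<delta>\<^sup>2)"
      using rC(4) that T(1) by (intro sum_mono) auto
    finally show ?thesis by (simp add: sum_distrib_right)
  qed
  moreover have "(\<Sum>p\<in>T. C p) \<ge> 0" using rC(2) T(1) by (intro sum_nonneg) auto
  ultimately show ?thesis by blast
qed

text \<open>On each box of a countable cover the zero set lies in every sublevel set, so its measure
  is at most \<open>C * \<delta>\<^sup>2\<close> for arbitrarily small \<delta>.\<close>

lemma negligible_zero_set:
  fixes G :: "real^'n::finite \<Rightarrow> real^'n"
  assumes \<Omega>: "open \<Omega>" and G: "\<And>i. Ck_on (Suc 0) (\<lambda>x. G x $ i) \<Omega>"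
    and rank: "\<And>p. p \<in> \<Omega> \<Longrightarrow> rank (\<chi> i j. jac G p $ i $ j - jac G p $ j $ i) > 2"
  shows "negligible {x \<in> \<Omega>. G x = 0}"
proof -
  obtain D where D: "countable D" "D \<subseteq> Pow \<Omega>" "\<And>X. X \<in> D \<Longrightarrow> \<exists>a b. X = cbox a b" "\<Union>D = \<Omega>"
    using open_countable_Union_open_cbox[OF \<Omega>] by metis
  have "negligible {x \<in> X. G x = 0}" if X: "X \<in> D" for X
  proof -
    have K: "compact X" "X \<subseteq> \<Omega>" using D(2,3) X compact_cbox by blast+
    obtain C where C: "\<And>\<delta>. \<delta> > 0 \<Longrightarrow> measure lebesgue {x \<in> X. norm (G x) \<le> \<delta>} \<le> C * \<delta>\<^sup>2"
      using sublevel_measure_compact[OF \<Omega> G rank K] by blast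
    note lm = lmeasurable_compact[OF compact_sublevel_norm[OF K(1) continuous_on_subset[OF C1_on_vec_continuous_on[OF G] K(2)]]]
    have eq: "{x \<in> X. G x = 0} = {x \<in> X. norm (G x) \<le> 0}" by simp
    let ?h = "\<lambda>n. inverse (real (Suc n))"
    have "measure lebesgue {x \<in> X. norm (G x) \<le> 0} \<le> C * (?h n)\<^sup>2" for n
    proof -
      have "measure lebesgue {x \<in> X. norm (G x) \<le> 0} \<le> measure lebesgue {x \<in> X. norm (G x) \<le> ?h n}"
        by (rule measure_mono_fmeasurable[OF _ fmeasurableD[OF lm] lm]) (auto intro: order_trans)
      also have "\<dots> \<le> C * (?h n)\<^sup>2" by (rule C) simp
      finally show ?thesis .
    qed
    moreover have "(\<lambda>n. C * (?h n)\<^sup>2) \<longlonglongrightarrow> C * 0\<^sup>2"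
      by (intro tendsto_mult tendsto_power tendsto_const LIMSEQ_inverse_real_of_nat)
    ultimately have "measure lebesgue {x \<in> X. norm (G x) \<le> 0} \<le> C * 0\<^sup>2"
      by (intro tendsto_lowerbound[where F = sequentially and f = "\<lambda>n. C * (?h n)\<^sup>2"]) auto
    then have "measure lebesgue {x \<in> X. norm (G x) \<le> 0} = 0"
      by (simp add: measure_le_0_iff)
    then show ?thesis
      unfolding eq using lm[of 0] by (simp only: negligible_iff_measure)
  qed
  then have "negligible (\<Union>X\<in>D. {x \<in> X. G x = 0})"
    using D(1) by (intro negligible_countable_Union) auto
  also have "(\<Union>X\<in>D. {x \<in> X. G x = 0}) = {x \<in> \<Omega>. G x = 0}" using D(4) by auto
  finally show ?thesis .
qed

subsection \<open>The regularised unit field\<close>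

text \<open>The regularisation \<open>G / sqrt (\<bar>G\<bar>\<^sup>2 + \<epsilon>\<^sup>2)\<close> of the unit field \<open>G / \<bar>G\<bar>\<close> is \<open>C\<^sup>1\<close> across the zeros
  of \<open>G\<close>.\<close>

definition reg_weight :: "(real^'n::finite \<Rightarrow> real^'n) \<Rightarrow> real \<Rightarrow> real^'n \<Rightarrow> real" where
  "reg_weight G \<epsilon> x = 1 / sqrt (G x \<bullet> G x + \<epsilon>\<^sup>2)"

context
  fixes \<Omega> :: "(real^'n::finite) set" and G :: "real^'n \<Rightarrow> real^'n"
  assumes \<Omega>: "open \<Omega>" and G: "\<And>i. Ck_on (Suc 0) (\<lambda>x. G x $ i) \<Omega>"
begin

text \<open>The regularisation is written through the square of the norm, which unlike the norm
  itself stays C^1 at the zeros of G.\<close>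

lemma C1_inner_self: "Ck_on (Suc 0) (\<lambda>x. G x \<bullet> G x) \<Omega>"
  unfolding inner_vec_def inner_real_def by (intro Ck_on_sum Ck_on_mult G \<Omega>)

lemma partial_deriv_inner_self:
  assumes "x \<in> \<Omega>"
  shows "partial_deriv i (\<lambda>x. G x \<bullet> G x) x = 2 * (G x \<bullet> column i (jac G x))"
proof -
  have "(G has_derivative (*v) (jac G x)) (at x)"
    using G assms by (intro has_derivative_jac) auto
  from partial_deriv_eqI[OF has_derivative_inner[OF this this], of i]
  show ?thesis by (simp add: matrix_vector_mult_basis inner_commute)
qed

lemma C1_reg_weight:
  assumes "\<epsilon> > 0"
  shows "Ck_on (Suc 0) (reg_weight G \<epsilon>) \<Omega>"
  unfolding reg_weight_def
proof (rule C1_on_compose[OF C1_inner_self])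
  have pos: "0 < t + \<epsilon>\<^sup>2" if "t \<in> {0..}" for t using that assms by (simp add: add_nonneg_pos)
  show "((\<lambda>s. 1 / sqrt (s + \<epsilon>\<^sup>2)) has_real_derivative (- (inverse (sqrt (t + \<epsilon>\<^sup>2)) / 2) / (sqrt (t + \<epsilon>\<^sup>2))\<^sup>2)) (at t)"
    if "t \<in> {0..}" for t
    using pos[OF that] by (auto intro!: derivative_eq_intros simp: power2_eq_square)
  show "continuous_on {0..} (\<lambda>t. - (inverse (sqrt (t + \<epsilon>\<^sup>2)) / 2) / (sqrt (t + \<epsilon>\<^sup>2))\<^sup>2)"
    using pos by (intro continuous_intros) (force simp: real_sqrt_eq_zero_cancel_iff)+
qed auto

lemma C1_reg_field:
  assumes "\<epsilon> > 0"
  shows "Ck_on (Suc 0) (\<lambda>x. G x $ i * reg_weight G \<epsilon> x) \<Omega>"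
  by (intro Ck_on_mult \<Omega> G C1_reg_weight assms)

text \<open>With s the squared norm of G, this is the factor \<lambda> between the regularised field
  and the unit field. The square root in the numerator is singular at 0, hence s > 0.\<close>

lemma reg_factor_derivative:
  assumes "s > 0" "\<epsilon> > (0::real)"
  shows "((\<lambda>s. sqrt s / sqrt (s + \<epsilon>\<^sup>2)) has_real_derivative \<epsilon>\<^sup>2 / (2 * sqrt s * ((s + \<epsilon>\<^sup>2) * sqrt (s + \<epsilon>\<^sup>2)))) (at s)"
proof -
  have pos: "0 < s + \<epsilon>\<^sup>2" using assms by (simp add: add_pos_pos)
  \<comment> \<open>In terms of a and b the claim is a rational identity, with
    \<open>\<epsilon>\<^sup>2 = b\<^sup>2 - a\<^sup>2\<close>.\<close>
  define a b where "a = sqrt s" and "b = sqrt (s + \<epsilon>\<^sup>2)"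
  have ab: "a > 0" "b > 0" "s = a\<^sup>2" "s + \<epsilon>\<^sup>2 = b\<^sup>2" "\<epsilon>\<^sup>2 = b\<^sup>2 - a\<^sup>2"
    using assms by (auto simp: a_def b_def add_pos_pos)
  have D: "((\<lambda>s. sqrt s / sqrt (s + \<epsilon>\<^sup>2)) has_real_derivative
      (inverse (sqrt s) / 2 * sqrt (s + \<epsilon>\<^sup>2) - sqrt s * (inverse (sqrt (s + \<epsilon>\<^sup>2)) / 2)) / (sqrt (s + \<epsilon>\<^sup>2) * sqrt (s + \<epsilon>\<^sup>2))) (at s)"
    using assms pos by (auto intro!: derivative_eq_intros simp del: real_sqrt_mult_self)
  have e: "(inverse a / 2 * b - a * (inverse b / 2)) / (b * b) = (b\<^sup>2 - a\<^sup>2) / (2 * a * (b\<^sup>2 * b))"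
    using ab(1,2) by (simp add: field_simps power2_eq_square)
  show ?thesis
    by (rule DERIV_cong[OF D], unfold a_def[symmetric] b_def[symmetric], unfold ab(4), unfold ab(5)) (rule e)
qed

text \<open>Off the zeros of G the regularised field is l N with N the unit field, so its divergence
  is l div N plus the inner product of N and grad l. The second term is the error to be
  estimated.\<close>

lemma divergence_reg_field:
  assumes x: "x \<in> \<Omega>" "G x \<noteq> 0" and \<epsilon>: "\<epsilon> > 0"
  shows "\<bar>(\<Sum>i\<in>UNIV. partial_deriv i (\<lambda>y. G y $ i * reg_weight G \<epsilon> y) x)
      - norm (G x) * reg_weight G \<epsilon> x * divergence (\<lambda>y. (1 / norm (G y)) *\<^sub>R G y) x\<bar>
    \<le> \<epsilon>\<^sup>2 / ((G x \<bullet> G x + \<epsilon>\<^sup>2) * sqrt (G x \<bullet> G x + \<epsilon>\<^sup>2)) * (\<Sum>i\<in>UNIV. norm (column i (jac G x)))"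
proof -
  let ?q = "\<lambda>y. G y \<bullet> G y"
  define N where "N i y = G y $ i * (1 / sqrt (?q y))" for i y
  define l where "l y = sqrt (?q y) / sqrt (?q y + \<epsilon>\<^sup>2)" for y
  \<comment> \<open>The factorisation l N is differentiated, so it must hold on a whole
    neighbourhood of x, not only at x.\<close>
  define U where "U = \<Omega> \<inter> G -` (- {0})"
  have U: "open U" "x \<in> U"
    unfolding U_def using C1_on_vec_continuous_on[OF G] \<Omega> x
    by (auto intro!: continuous_open_preimage)
  have q0: "?q x > 0" using x by simp
  have qd: "?q differentiable (at x)" and Gd: "(\<lambda>y. G y $ i) differentiable (at x)" for i
    using C1_inner_self G x by auto
  have ld: "l differentiable (at x)"
    and lp: "partial_deriv i l x = \<epsilon>\<^sup>2 / (2 * sqrt (?q x) * ((?q x + \<epsilon>\<^sup>2) * sqrt (?q x + \<epsilon>\<^sup>2))) * partial_deriv i ?q x" for i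
    unfolding l_def
    using differentiable_compose_real[OF qd reg_factor_derivative[OF q0 \<epsilon>]]
      partial_deriv_compose[OF qd reg_factor_derivative[OF q0 \<epsilon>]] by auto
  have "((\<lambda>s. 1 / sqrt s) has_real_derivative (- (inverse (sqrt s) / 2) / (sqrt s)\<^sup>2)) (at s)" if "s > 0" for s
    using that by (auto intro!: derivative_eq_intros simp: power2_eq_square)
  from differentiable_compose_real[OF qd this[OF q0]] have Nd: "N i differentiable (at x)" for i
    unfolding N_def by (intro differentiable_mult Gd)
  have dp: "partial_deriv i (\<lambda>y. G y $ i * reg_weight G \<epsilon> y) x = l x * partial_deriv i (N i) x + partial_deriv i l x * N i x" for i
  proof -
    have "partial_deriv i (\<lambda>y. G y $ i * reg_weight G \<epsilon> y) x = partial_deriv i (\<lambda>y. l y * N i y) x"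
      by (rule partial_deriv_cong[OF U]) (auto simp: U_def N_def l_def reg_weight_def)
    then show ?thesis using partial_deriv_mult[OF ld Nd] by simp
  qed
  have div: "divergence (\<lambda>y. (1 / norm (G y)) *\<^sub>R G y) x = (\<Sum>i\<in>UNIV. partial_deriv i (N i) x)"
    unfolding divergence_def N_def by (simp add: norm_eq_sqrt_inner mult.commute)
  have lx: "norm (G x) * reg_weight G \<epsilon> x = l x"
    by (simp add: l_def reg_weight_def norm_eq_sqrt_inner)
  let ?e = "\<epsilon>\<^sup>2 / ((?q x + \<epsilon>\<^sup>2) * sqrt (?q x + \<epsilon>\<^sup>2))"
  have e0: "?e \<ge> 0" by simp
  have b: "\<bar>partial_deriv i l x * N i x\<bar> \<le> ?e * norm (column i (jac G x))" for i
  proof -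
    have g: "sqrt (?q x) = norm (G x)" "norm (G x) > 0" using x by (auto simp: norm_eq_sqrt_inner)
    \<comment> \<open>The 2 from differentiating the squared norm cancels the 2 in the derivative of
      the factor; the remaining 1 / norm is absorbed by Cauchy-Schwarz.\<close>
    have "partial_deriv i l x = ?e * ((G x \<bullet> column i (jac G x)) / norm (G x))"
      using g(2) by (simp add: lp partial_deriv_inner_self[OF x(1)] g(1))
    moreover have "\<bar>(G x \<bullet> column i (jac G x)) / norm (G x)\<bar> \<le> norm (column i (jac G x))"
      using Cauchy_Schwarz_ineq2[of "G x" "column i (jac G x)"] g(2)
      by (simp add: field_simps)
    moreover have "\<bar>N i x\<bar> \<le> 1"
      using component_le_norm_cart[of "G x" i] g by (simp add: N_def)
    ultimately show ?thesis
      using e0 mult_mono[of "?e * \<bar>(G x \<bullet> column i (jac G x)) / norm (G x)\<bar>" "?e * norm (column i (jac G x))" "\<bar>N i x\<bar>" 1]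
      by (simp only: abs_mult abs_of_nonneg mult_left_mono mult_1_right norm_ge_zero abs_ge_zero mult_nonneg_nonneg)
  qed
  have "(\<Sum>i\<in>UNIV. partial_deriv i (\<lambda>y. G y $ i * reg_weight G \<epsilon> y) x)
      - norm (G x) * reg_weight G \<epsilon> x * divergence (\<lambda>y. (1 / norm (G y)) *\<^sub>R G y) x
     = (\<Sum>i\<in>UNIV. partial_deriv i l x * N i x)"
    unfolding dp div lx by (simp add: sum.distrib sum_distrib_left)
  also have "\<bar>\<dots>\<bar> \<le> (\<Sum>i\<in>UNIV. \<bar>partial_deriv i l x * N i x\<bar>)" by (rule sum_abs)
  also have "\<dots> \<le> (\<Sum>i\<in>UNIV. ?e * norm (column i (jac G x)))" by (rule sum_mono) (rule b)
  finally show ?thesis by (simp add: sum_distrib_left)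
qed

end

subsection \<open>The equation across the singular set\<close>

text \<open>The denominator is the cube of \<open>sqrt (n\<^sup>2 + \<epsilon>\<^sup>2)\<close>: it
  is always at least \<open>\<epsilon> ^ 3\<close>, and at least \<open>\<delta> ^ 3\<close> when n
  exceeds \<delta>. The large value 1 / \<epsilon> is thus charged only to the sublevel set, whose
  measure is quadratic in \<delta>.\<close>

lemma reg_error_le:
  fixes n \<epsilon> \<delta> :: real
  assumes "n \<ge> 0" "\<epsilon> > 0" "\<delta> > 0"
  shows "\<epsilon>\<^sup>2 / ((n\<^sup>2 + \<epsilon>\<^sup>2) * sqrt (n\<^sup>2 + \<epsilon>\<^sup>2)) \<le> (if n \<le> \<delta> then 1 / \<epsilon> else 0) + \<epsilon>\<^sup>2 / \<delta> ^ 3"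
proof -
  have le: "a ^ 3 \<le> (n\<^sup>2 + \<epsilon>\<^sup>2) * sqrt (n\<^sup>2 + \<epsilon>\<^sup>2)" if "a > 0" "a\<^sup>2 \<le> n\<^sup>2 + \<epsilon>\<^sup>2" for a
  proof -
    have "a\<^sup>2 * a \<le> (n\<^sup>2 + \<epsilon>\<^sup>2) * sqrt (n\<^sup>2 + \<epsilon>\<^sup>2)"
      using that by (intro mult_mono real_le_rsqrt) auto
    then show ?thesis by (simp add: power3_eq_cube power2_eq_square)
  qed
  show ?thesis
  proof (cases "n \<le> \<delta>")
    case True
    have "\<epsilon>\<^sup>2 / ((n\<^sup>2 + \<epsilon>\<^sup>2) * sqrt (n\<^sup>2 + \<epsilon>\<^sup>2)) \<le> \<epsilon>\<^sup>2 / \<epsilon> ^ 3"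
      using le[of \<epsilon>] assms by (intro divide_left_mono) (auto intro!: mult_pos_pos add_nonneg_pos)
    also have "\<dots> = 1 / \<epsilon>" using assms by (simp add: power3_eq_cube power2_eq_square)
    also have "\<dots> \<le> 1 / \<epsilon> + \<epsilon>\<^sup>2 / \<delta> ^ 3" using assms by simp
    finally show ?thesis using True by simp
  next
    case False
    then have "\<delta>\<^sup>2 \<le> n\<^sup>2 + \<epsilon>\<^sup>2" using assms by (intro order_trans[OF power_mono[of \<delta> n 2]]) auto
    then have "\<epsilon>\<^sup>2 / ((n\<^sup>2 + \<epsilon>\<^sup>2) * sqrt (n\<^sup>2 + \<epsilon>\<^sup>2)) \<le> \<epsilon>\<^sup>2 / \<delta> ^ 3"
      using le[of \<delta>] assms by (intro divide_left_mono) (auto intro!: mult_pos_pos add_nonneg_pos)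
    then show ?thesis using False by simp
  qed
qed

lemma reg_weight_bounds:
  assumes "\<epsilon> > 0"
  shows "0 \<le> norm (G x) * reg_weight G \<epsilon> x" "norm (G x) * reg_weight G \<epsilon> x \<le> 1" "reg_weight G \<epsilon> x > 0"
proof -
  have pos: "G x \<bullet> G x + \<epsilon>\<^sup>2 > 0" using assms by (intro add_nonneg_pos) auto
  have "norm (G x) \<le> sqrt (G x \<bullet> G x + \<epsilon>\<^sup>2)" by (simp add: norm_eq_sqrt_inner)
  with pos show "norm (G x) * reg_weight G \<epsilon> x \<le> 1" by (simp add: reg_weight_def)
  show "reg_weight G \<epsilon> x > 0" "0 \<le> norm (G x) * reg_weight G \<epsilon> x"
    using pos by (auto simp: reg_weight_def intro: less_imp_le)
qed

lemma reg_weight_tendsto: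
  assumes "G x \<noteq> 0" "\<epsilon> \<longlonglongrightarrow> 0"
  shows "(\<lambda>n. reg_weight G (\<epsilon> n) x) \<longlonglongrightarrow> 1 / norm (G x)"
proof -
  have "(\<lambda>n. 1 / sqrt (G x \<bullet> G x + (\<epsilon> n)\<^sup>2)) \<longlonglongrightarrow> 1 / sqrt (G x \<bullet> G x + 0\<^sup>2)"
    using assms by (intro tendsto_intros) auto
  then show ?thesis by (simp add: reg_weight_def norm_eq_sqrt_inner)
qed

text \<open>The potential u and the field F enter only through their combination G. For G = grad u +
  F the skew part of the Jacobian is the curl matrix of F, so the rank condition can be put on
  G.\<close>

locale unit_field_equation =
  fixes \<Omega> :: "(real^'n::finite) set" and G :: "real^'n \<Rightarrow> real^'n" and H :: "real^'n \<Rightarrow> real"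
  assumes \<Omega>: "open \<Omega>" and G: "\<And>i. Ck_on (Suc 0) (\<lambda>x. G x $ i) \<Omega>"
    and rank: "\<And>p. p \<in> \<Omega> \<Longrightarrow> rank (\<chi> i j. jac G p $ i $ j - jac G p $ j $ i) > 2"
    and H: "L_infty \<Omega> H"
    and div: "\<And>x. x \<in> \<Omega> \<Longrightarrow> G x \<noteq> 0 \<Longrightarrow> divergence (\<lambda>y. (1 / norm (G y)) *\<^sub>R G y) x = H x"
begin

lemma \<Omega>_sets: "\<Omega> \<in> sets lebesgue" using \<Omega> by simp

lemma AE_G_nonzero: "AE x in lebesgue_on \<Omega>. G x \<noteq> 0"
proof -
  have "AE x in lebesgue. x \<notin> {x \<in> \<Omega>. G x = 0}"
    using negligible_zero_set[OF \<Omega> G rank] unfolding negligible_iff_null_sets by (rule AE_not_in)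
  then show ?thesis using \<Omega>_sets by (simp add: AE_restrict_space_iff)
qed

lemma G_measurable: "G \<in> borel_measurable (lebesgue_on \<Omega>)"
  using C1_on_vec_continuous_on[OF G] \<Omega>_sets by (rule continuous_imp_measurable_on_sets_lebesgue)

lemma reg_weight_measurable: "\<epsilon> > 0 \<Longrightarrow> reg_weight G \<epsilon> \<in> borel_measurable (lebesgue_on \<Omega>)"
  using Ck_on_continuous_on[OF C1_reg_weight[OF \<Omega> G]] \<Omega>_sets
  by (rule continuous_imp_measurable_on_sets_lebesgue)

lemma grad_measurable: "Ck_on (Suc 0) \<phi> UNIV \<Longrightarrow> grad \<phi> \<in> borel_measurable (lebesgue_on \<Omega>)"
  unfolding grad_def
  by (intro continuous_imp_measurable_on_sets_lebesgue \<Omega>_sets continuous_on_vec_lambda)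
    (auto intro: continuous_on_subset)

context
  fixes \<phi> K
  assumes \<phi>: "Ck_on (Suc 0) \<phi> UNIV" and K: "compact K" "K \<subseteq> \<Omega>"
    and \<phi>0: "\<And>x. x \<notin> K \<Longrightarrow> \<phi> x = 0" "\<And>x i. x \<notin> K \<Longrightarrow> partial_deriv i \<phi> x = 0"
begin

text \<open>The integrand of the weak equation multiplied by the factor \<lambda> = |G| / sqrt(|G|^2
  + \<epsilon>^2). Here \<lambda> N is the regularised field and \<lambda> H the main part of its
  divergence.\<close>

definition reg_integrand :: "real \<Rightarrow> real^'n \<Rightarrow> real" where
  "reg_integrand \<epsilon> x = reg_weight G \<epsilon> x * (G x \<bullet> grad \<phi> x) + (H x * \<phi> x) * (norm (G x) * reg_weight G \<epsilon> x)"

lemma H\<phi>_integrable: "integrable (lebesgue_on \<Omega>) (\<lambda>x. H x * \<phi> x)"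
  using L1_loc_L_infty[OF \<Omega> H] K \<Omega>_sets
  by (rule integrable_L1_loc_mult) (use \<phi>0 Ck_on_continuous_on[OF \<phi>] in \<open>auto intro: continuous_on_subset\<close>)

lemma norm_grad_integrable: "integrable (lebesgue_on \<Omega>) (\<lambda>x. norm (grad \<phi> x))"
proof -
  have "continuous_on K (grad \<phi>)"
    unfolding grad_def using \<phi> by (intro continuous_on_vec_lambda) (auto intro: continuous_on_subset)
  then have c: "continuous_on K (\<lambda>x. norm (grad \<phi> x))" by (rule continuous_on_norm)
  have "grad \<phi> x = 0" if "x \<notin> K" for x using \<phi>0(2)[OF that] by (simp add: vec_eq_iff)
  then have "integrable (lebesgue_on \<Omega>) (\<lambda>x. 1 * norm (grad \<phi> x))"
    by (intro integrable_L1_loc_mult[OF L1_loc_continuous K \<Omega>_sets c] continuous_on_const) auto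
  then show ?thesis by simp
qed

lemma reg_integrand_integrable:
  assumes "\<epsilon> > 0"
  shows "integrable (lebesgue_on \<Omega>) (reg_integrand \<epsilon>)"
  unfolding reg_integrand_def
proof (rule Bochner_Integration.integrable_add)
  note [measurable] = G_measurable reg_weight_measurable[OF assms] grad_measurable[OF \<phi>]
  show "integrable (lebesgue_on \<Omega>) (\<lambda>x. reg_weight G \<epsilon> x * (G x \<bullet> grad \<phi> x))"
  proof (rule Bochner_Integration.integrable_bound[OF norm_grad_integrable])
    have "\<bar>reg_weight G \<epsilon> x * (G x \<bullet> grad \<phi> x)\<bar> \<le> norm (grad \<phi> x)" for x
    proof -
      have "\<bar>reg_weight G \<epsilon> x * (G x \<bullet> grad \<phi> x)\<bar> \<le> reg_weight G \<epsilon> x * (norm (G x) * norm (grad \<phi> x))"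
        using reg_weight_bounds(3)[OF assms, of G x] Cauchy_Schwarz_ineq2[of "G x" "grad \<phi> x"]
        by (simp add: abs_mult)
      also have "\<dots> = (norm (G x) * reg_weight G \<epsilon> x) * norm (grad \<phi> x)" by simp
      also have "\<dots> \<le> 1 * norm (grad \<phi> x)"
        using reg_weight_bounds(2)[OF assms] by (intro mult_right_mono) auto
      finally show ?thesis by simp
    qed
    then show "AE x in lebesgue_on \<Omega>. norm (reg_weight G \<epsilon> x * (G x \<bullet> grad \<phi> x)) \<le> norm (norm (grad \<phi> x))"
      by simp
  qed measurable
  show "integrable (lebesgue_on \<Omega>) (\<lambda>x. H x * \<phi> x * (norm (G x) * reg_weight G \<epsilon> x))"
  proof (rule integrable_mult_bounded[OF H\<phi>_integrable])
    show "AE x in lebesgue_on \<Omega>. \<bar>norm (G x) * reg_weight G \<epsilon> x\<bar> \<le> 1"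
      by (rule AE_I2) (simp only: abs_of_nonneg reg_weight_bounds[OF assms])
  qed measurable
qed

lemma reg_integral_by_parts:
  assumes \<epsilon>: "\<epsilon> > 0"
  defines "D \<equiv> \<lambda>x. reg_weight G \<epsilon> x * (G x \<bullet> grad \<phi> x)
      + (\<Sum>i\<in>UNIV. partial_deriv i (\<lambda>y. G y $ i * reg_weight G \<epsilon> y) x) * \<phi> x"
  shows "integrable (lebesgue_on \<Omega>) D" "integral\<^sup>L (lebesgue_on \<Omega>) D = 0"
proof -
  let ?X = "\<lambda>i y. G y $ i * reg_weight G \<epsilon> y"
  note parts = integral_by_parts_compact_support[OF \<Omega> K C1_reg_field[OF \<Omega> G \<epsilon>] \<phi> \<phi>0(1)]
  have D: "D = (\<lambda>x. \<Sum>i\<in>UNIV. ?X i x * partial_deriv i \<phi> x + partial_deriv i (?X i) x * \<phi> x)"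
    by (simp add: D_def fun_eq_iff sum.distrib inner_vec_def sum_distrib_left sum_distrib_right mult_ac)
  show "integrable (lebesgue_on \<Omega>) D"
    unfolding D by (intro Bochner_Integration.integrable_sum Bochner_Integration.integrable_add parts(1,2)) auto
  show "integral\<^sup>L (lebesgue_on \<Omega>) D = 0"
    unfolding D using parts by (simp add: Bochner_Integration.integral_sum)
qed

text \<open>By parts, the exact integrand D of the regularised field integrates to 0, so only its
  difference from \<open>reg_integrand\<close> counts. That difference is \<phi> times the
  divergence error, which is split at |G| = \<delta> and integrated with the quadratic measure
  bound.\<close>

lemma reg_integral_bound:
  "\<exists>B\<ge>0. \<forall>\<epsilon>>0. \<forall>\<delta>>0. \<bar>integral\<^sup>L (lebesgue_on \<Omega>) (reg_integrand \<epsilon>)\<bar> \<le> B * (\<delta>\<^sup>2 / \<epsilon> + \<epsilon>\<^sup>2 / \<delta> ^ 3)"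
proof -
  obtain C where C: "C \<ge> 0" "\<And>\<delta>. \<delta> > 0 \<Longrightarrow> measure lebesgue {x \<in> K. norm (G x) \<le> \<delta>} \<le> C * \<delta>\<^sup>2"
    using sublevel_measure_compact[OF \<Omega> G rank K] by blast
  let ?J = "\<lambda>x. \<Sum>i\<in>UNIV. norm (column i (jac G x))"
  have cont: "continuous_on K G"
    by (rule continuous_on_subset[OF C1_on_vec_continuous_on[OF G] K(2)])
  have "continuous_on K (\<lambda>x. \<phi> x * ?J x)"
    unfolding jac_def column_def using G K(2) Ck_on_continuous_on[OF \<phi>]
    by (intro continuous_on_mult continuous_on_sum continuous_on_norm continuous_on_vec_lambda)
      (auto intro: continuous_on_subset)
  then obtain P where P: "\<And>x. x \<in> K \<Longrightarrow> \<bar>\<phi> x * ?J x\<bar> \<le> P"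
    using compact_imp_bounded[OF compact_continuous_image[OF _ K(1)]]
    by (fastforce simp: bounded_iff)
  \<comment> \<open>The maximum with 0 covers an empty K, for which P is arbitrary.\<close>
  define P' where "P' = max P 0"
  have P': "P' \<ge> 0" "\<And>x. x \<in> K \<Longrightarrow> \<bar>\<phi> x\<bar> * ?J x \<le> P'"
  proof -
    show "P' \<ge> 0" by (simp add: P'_def)
    fix x assume "x \<in> K"
    have "\<bar>\<phi> x\<bar> * ?J x = \<bar>\<phi> x * ?J x\<bar>" by (simp add: abs_mult sum_nonneg)
    also have "\<dots> \<le> P'" using P[OF \<open>x \<in> K\<close>] by (simp add: P'_def)
    finally show "\<bar>\<phi> x\<bar> * ?J x \<le> P'" .
  qed
  define B where "B = P' * (C + measure lebesgue K)"
  have "\<bar>integral\<^sup>L (lebesgue_on \<Omega>) (reg_integrand \<epsilon>)\<bar> \<le> B * (\<delta>\<^sup>2 / \<epsilon> + \<epsilon>\<^sup>2 / \<delta> ^ 3)"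
    if \<epsilon>: "\<epsilon> > 0" and \<delta>: "\<delta> > 0" for \<epsilon> \<delta>
  proof -
    define D where "D x = reg_weight G \<epsilon> x * (G x \<bullet> grad \<phi> x)
      + (\<Sum>i\<in>UNIV. partial_deriv i (\<lambda>y. G y $ i * reg_weight G \<epsilon> y) x) * \<phi> x" for x
    have D: "integrable (lebesgue_on \<Omega>) D" "integral\<^sup>L (lebesgue_on \<Omega>) D = 0"
      using reg_integral_by_parts[OF \<epsilon>] by (simp_all add: D_def[abs_def])
    note Q = reg_integrand_integrable[OF \<epsilon>]
    let ?E = "{x \<in> K. norm (G x) \<le> \<delta>}"
    have E: "?E \<in> lmeasurable" "K \<in> lmeasurable"
      using K(1) cont by (auto intro!: lmeasurable_compact compact_sublevel_norm)
    define b where "b x = P' * (indicator ?E x * (1 / \<epsilon>) + indicator K x * (\<epsilon>\<^sup>2 / \<delta> ^ 3))" for x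
    note ind = indicator_lebesgue_on[OF \<Omega>_sets]
    have b: "integrable (lebesgue_on \<Omega>) b"
      "integral\<^sup>L (lebesgue_on \<Omega>) b = P' * (measure lebesgue ?E * (1 / \<epsilon>) + measure lebesgue K * (\<epsilon>\<^sup>2 / \<delta> ^ 3))"
    proof -
      have EK: "?E \<subseteq> \<Omega>" using K(2) by auto
      note i = ind[OF E(1) EK] ind[OF E(2) K(2)]
      show "integrable (lebesgue_on \<Omega>) b"
        unfolding b_def using i by (intro integrable_mult_right Bochner_Integration.integrable_add integrable_mult_left) auto
      show "integral\<^sup>L (lebesgue_on \<Omega>) b = P' * (measure lebesgue ?E * (1 / \<epsilon>) + measure lebesgue K * (\<epsilon>\<^sup>2 / \<delta> ^ 3))"
        unfolding b_def using i by simp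
    qed
    \<comment> \<open>Off the zeros of G the equation turns H into the divergence of the unit field,
      and \<open>divergence_reg_field\<close> applies.\<close>
    have "\<bar>D x - reg_integrand \<epsilon> x\<bar> \<le> b x" if x: "x \<in> \<Omega>" "G x \<noteq> 0" for x
    proof (cases "x \<in> K")
      case True
      have "D x - reg_integrand \<epsilon> x = ((\<Sum>i\<in>UNIV. partial_deriv i (\<lambda>y. G y $ i * reg_weight G \<epsilon> y) x)
          - norm (G x) * reg_weight G \<epsilon> x * divergence (\<lambda>y. (1 / norm (G y)) *\<^sub>R G y) x) * \<phi> x"
        by (simp add: D_def reg_integrand_def div[OF x] algebra_simps)
      also have "\<bar>\<dots>\<bar> \<le> \<epsilon>\<^sup>2 / ((G x \<bullet> G x + \<epsilon>\<^sup>2) * sqrt (G x \<bullet> G x + \<epsilon>\<^sup>2)) * ?J x * \<bar>\<phi> x\<bar>"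
        unfolding abs_mult using divergence_reg_field[OF \<Omega> G x \<epsilon>] by (rule mult_right_mono) simp
      also have "\<dots> = \<epsilon>\<^sup>2 / (((norm (G x))\<^sup>2 + \<epsilon>\<^sup>2) * sqrt ((norm (G x))\<^sup>2 + \<epsilon>\<^sup>2)) * (\<bar>\<phi> x\<bar> * ?J x)"
        by (simp add: power2_norm_eq_inner)
      also have "\<dots> \<le> ((if norm (G x) \<le> \<delta> then 1 / \<epsilon> else 0) + \<epsilon>\<^sup>2 / \<delta> ^ 3) * P'"
        using reg_error_le[OF norm_ge_zero \<epsilon> \<delta>, of "G x"] P'(2)[OF True] \<epsilon> \<delta>
        by (intro mult_mono) (auto intro!: mult_nonneg_nonneg sum_nonneg add_nonneg_nonneg)
      also have "\<dots> = b x" using True by (simp add: b_def)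
      finally show ?thesis .
    next
      case False
      have "grad \<phi> x = 0" using \<phi>0(2)[OF False] by (simp add: vec_eq_iff)
      then show ?thesis using False \<phi>0(1)[OF False] by (simp add: D_def reg_integrand_def b_def)
    qed
    then have ae: "AE x in lebesgue_on \<Omega>. \<bar>D x - reg_integrand \<epsilon> x\<bar> \<le> b x"
      using AE_G_nonzero by (auto elim!: eventually_mono[rotated] simp: AE_restrict_space_iff \<Omega>_sets)
    have "\<bar>integral\<^sup>L (lebesgue_on \<Omega>) (reg_integrand \<epsilon>)\<bar> = \<bar>LINT x|lebesgue_on \<Omega>. D x - reg_integrand \<epsilon> x\<bar>"
      using D Q by simp
    also have "\<dots> \<le> (LINT x|lebesgue_on \<Omega>. \<bar>D x - reg_integrand \<epsilon> x\<bar>)"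
      by (rule integral_abs_bound)
    also have "\<dots> \<le> integral\<^sup>L (lebesgue_on \<Omega>) b"
      using D(1) Q b(1) ae by (intro integral_mono_AE) auto
    also have "\<dots> \<le> P' * (C * (\<delta>\<^sup>2 / \<epsilon>) + measure lebesgue K * (\<epsilon>\<^sup>2 / \<delta> ^ 3))"
      unfolding b(2) using mult_right_mono[OF C(2)[OF \<delta>], of "1 / \<epsilon>"] P'(1) \<epsilon>
      by (intro mult_left_mono add_right_mono) auto
    also have "\<dots> \<le> P' * (C + measure lebesgue K) * (\<delta>\<^sup>2 / \<epsilon> + \<epsilon>\<^sup>2 / \<delta> ^ 3)"
    proof -
      have "C * (\<delta>\<^sup>2 / \<epsilon>) + measure lebesgue K * (\<epsilon>\<^sup>2 / \<delta> ^ 3)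
          \<le> (C + measure lebesgue K) * (\<delta>\<^sup>2 / \<epsilon>) + (C + measure lebesgue K) * (\<epsilon>\<^sup>2 / \<delta> ^ 3)"
        using C(1) \<epsilon> \<delta> by (intro add_mono mult_right_mono) auto
      from mult_left_mono[OF this P'(1)] show ?thesis
        by (simp only: mult.assoc distrib_left[of "C + measure lebesgue K", symmetric])
    qed
    finally show ?thesis by (simp add: B_def)
  qed
  moreover have "B \<ge> 0" using P'(1) C(1) by (simp add: B_def)
  ultimately show ?thesis by blast
qed

text \<open>With \<open>\<epsilon> = \<tau>\<^sup>5\<close> and \<open>\<delta> = \<tau>\<^sup>3\<close> the bound above is \<open>2 B \<tau>\<close>.\<close>

lemma unit_field_weak_equation:
  shows "integrable (lebesgue_on \<Omega>) (\<lambda>x. ((1 / norm (G x)) *\<^sub>R G x) \<bullet> grad \<phi> x)"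
    and "(LINT x|lebesgue_on \<Omega>. ((1 / norm (G x)) *\<^sub>R G x) \<bullet> grad \<phi> x) + (LINT x|lebesgue_on \<Omega>. H x * \<phi> x) = 0"
proof -
  let ?N = "\<lambda>x. ((1 / norm (G x)) *\<^sub>R G x) \<bullet> grad \<phi> x"
  note [measurable] = G_measurable grad_measurable[OF \<phi>]
  show N: "integrable (lebesgue_on \<Omega>) ?N"
  proof (rule Bochner_Integration.integrable_bound[OF norm_grad_integrable])
    \<comment> \<open>At a zero of G the convention 1 / 0 = 0 makes the unit field 0, so the bound
      holds there too.\<close>
    have "\<bar>?N x\<bar> \<le> norm (grad \<phi> x)" for x
      using Cauchy_Schwarz_ineq2[of "(1 / norm (G x)) *\<^sub>R G x" "grad \<phi> x"]
      by (cases "G x = 0") auto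
    then show "AE x in lebesgue_on \<Omega>. norm (?N x) \<le> norm (norm (grad \<phi> x))" by simp
  qed measurable
  obtain B where B: "\<And>\<epsilon> \<delta>. \<epsilon> > 0 \<Longrightarrow> \<delta> > 0 \<Longrightarrow>
      \<bar>integral\<^sup>L (lebesgue_on \<Omega>) (reg_integrand \<epsilon>)\<bar> \<le> B * (\<delta>\<^sup>2 / \<epsilon> + \<epsilon>\<^sup>2 / \<delta> ^ 3)"
    using reg_integral_bound by blast
  define \<tau> where "\<tau> n = inverse (real (Suc n))" for n
  have \<tau>: "\<tau> n > 0" for n by (simp add: \<tau>_def)
  have \<tau>0: "\<tau> \<longlonglongrightarrow> 0" unfolding \<tau>_def by (rule LIMSEQ_inverse_real_of_nat)
  have \<epsilon>0: "(\<lambda>n. \<tau> n ^ 5) \<longlonglongrightarrow> 0" using tendsto_power[OF \<tau>0, of 5] by simp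
  have le: "norm (integral\<^sup>L (lebesgue_on \<Omega>) (reg_integrand (\<tau> n ^ 5))) \<le> B * (2 * \<tau> n)" for n
  proof -
    have "(\<tau> n ^ 3)\<^sup>2 / \<tau> n ^ 5 + (\<tau> n ^ 5)\<^sup>2 / (\<tau> n ^ 3) ^ 3 = 2 * \<tau> n"
      using \<tau>[of n] by (simp add: field_simps eval_nat_numeral)
    then show ?thesis using B[of "\<tau> n ^ 5" "\<tau> n ^ 3"] \<tau>[of n] by simp
  qed
  have lim: "(\<lambda>n. B * (2 * \<tau> n)) \<longlonglongrightarrow> 0"
    using tendsto_mult[OF tendsto_const[of B] tendsto_mult[OF tendsto_const[of 2] \<tau>0]] by (simp only: mult_zero_right)
  have "(\<lambda>n. integral\<^sup>L (lebesgue_on \<Omega>) (reg_integrand (\<tau> n ^ 5))) \<longlonglongrightarrow> 0"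
    by (rule Lim_null_comparison[OF always_eventually lim]) (rule allI, rule le)
  moreover have "(\<lambda>n. integral\<^sup>L (lebesgue_on \<Omega>) (reg_integrand (\<tau> n ^ 5))) \<longlonglongrightarrow>
      (LINT x|lebesgue_on \<Omega>. ?N x + H x * \<phi> x)"
  proof (rule integral_dominated_convergence)
    show "(\<lambda>x. ?N x + H x * \<phi> x) \<in> borel_measurable (lebesgue_on \<Omega>)"
      using N H\<phi>_integrable by simp
    show "reg_integrand (\<tau> n ^ 5) \<in> borel_measurable (lebesgue_on \<Omega>)" for n
      using reg_integrand_integrable[of "\<tau> n ^ 5"] \<tau>[of n] by simp
    show "integrable (lebesgue_on \<Omega>) (\<lambda>x. norm (grad \<phi> x) + \<bar>H x * \<phi> x\<bar>)"
      using norm_grad_integrable H\<phi>_integrable by simp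
    \<comment> \<open>Off the null set of zeros of G the weight tends to 1 / |G|, so the factor at
      \<open>H x * \<phi> x\<close> tends to 1.\<close>
    show "AE x in lebesgue_on \<Omega>. (\<lambda>n. reg_integrand (\<tau> n ^ 5) x) \<longlonglongrightarrow> ?N x + H x * \<phi> x"
      using AE_G_nonzero
    proof eventually_elim
      case (elim x)
      have "(\<lambda>n. reg_integrand (\<tau> n ^ 5) x) \<longlonglongrightarrow>
          1 / norm (G x) * (G x \<bullet> grad \<phi> x) + H x * \<phi> x * (norm (G x) * (1 / norm (G x)))"
        unfolding reg_integrand_def
        by (intro tendsto_add tendsto_mult tendsto_const reg_weight_tendsto[where G = G and \<epsilon> = "\<lambda>n. \<tau> n ^ 5", OF elim \<epsilon>0])
      then show ?case using elim by simp
    qed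
    show "AE x in lebesgue_on \<Omega>. norm (reg_integrand (\<tau> n ^ 5) x) \<le> norm (grad \<phi> x) + \<bar>H x * \<phi> x\<bar>" for n
    proof (rule AE_I2)
      fix x
      have e: "\<tau> n ^ 5 > 0" using \<tau> by simp
      let ?w = "reg_weight G (\<tau> n ^ 5) x"
      note w = reg_weight_bounds[OF e, of G x]
      have "\<bar>?w * (G x \<bullet> grad \<phi> x)\<bar> \<le> ?w * (norm (G x) * norm (grad \<phi> x))"
        using w(3) Cauchy_Schwarz_ineq2[of "G x" "grad \<phi> x"] by (simp add: abs_mult)
      also have "\<dots> = (norm (G x) * ?w) * norm (grad \<phi> x)" by simp
      also have "\<dots> \<le> 1 * norm (grad \<phi> x)" using w(2) by (intro mult_right_mono) auto
      finally have 1: "\<bar>?w * (G x \<bullet> grad \<phi> x)\<bar> \<le> norm (grad \<phi> x)" by simp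
      have 2: "\<bar>H x * \<phi> x * (norm (G x) * ?w)\<bar> \<le> \<bar>H x * \<phi> x\<bar>"
        using w(1,2) unfolding abs_mult[of "H x * \<phi> x"] by (intro mult_left_le) auto
      from 1 2 show "norm (reg_integrand (\<tau> n ^ 5) x) \<le> norm (grad \<phi> x) + \<bar>H x * \<phi> x\<bar>"
        unfolding reg_integrand_def real_norm_def by linarith
    qed
  qed
  ultimately have "(LINT x|lebesgue_on \<Omega>. ?N x + H x * \<phi> x) = 0"
    by (rule LIMSEQ_unique[symmetric])
  then show "(LINT x|lebesgue_on \<Omega>. ?N x) + (LINT x|lebesgue_on \<Omega>. H x * \<phi> x) = 0"
    using N H\<phi>_integrable by simp
qed

end

end

subsection \<open>Weak solution and minimizer\<close>

context unit_field_equation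
begin

lemma test_fun_weak_equation:
  assumes "test_fun \<Omega> \<phi>"
  shows "(LINT x|lebesgue_on \<Omega>. ((1 / norm (G x)) *\<^sub>R G x) \<bullet> grad \<phi> x) + (LINT x|lebesgue_on \<Omega>. H x * \<phi> x) = 0"
    and "integrable (lebesgue_on \<Omega>) (\<lambda>x. ((1 / norm (G x)) *\<^sub>R G x) \<bullet> grad \<phi> x)"
    and "integrable (lebesgue_on \<Omega>) (\<lambda>x. H x * \<phi> x)"
    and "integrable (lebesgue_on \<Omega>) \<phi>"
    and "integrable (lebesgue_on \<Omega>) (grad \<phi>)"
    and "has_weak_grad \<Omega> \<phi> (grad \<phi>)"
proof -
  obtain K where K: "compact K" "K \<subseteq> \<Omega>" "\<And>x. x \<notin> K \<Longrightarrow> \<phi> x = 0" "\<And>x i. x \<notin> K \<Longrightarrow> partial_deriv i \<phi> x = 0"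
    "\<And>k. Ck_on k \<phi> UNIV"
    using assms by (rule test_funE) blast
  note a = K(5) K(1-4)
  show "(LINT x|lebesgue_on \<Omega>. ((1 / norm (G x)) *\<^sub>R G x) \<bullet> grad \<phi> x) + (LINT x|lebesgue_on \<Omega>. H x * \<phi> x) = 0"
    "integrable (lebesgue_on \<Omega>) (\<lambda>x. ((1 / norm (G x)) *\<^sub>R G x) \<bullet> grad \<phi> x)"
    "integrable (lebesgue_on \<Omega>) (\<lambda>x. H x * \<phi> x)"
    using unit_field_weak_equation[OF a] H\<phi>_integrable[OF a] by blast+
  show "integrable (lebesgue_on \<Omega>) (grad \<phi>)"
    using integrable_norm_iff[OF grad_measurable[OF K(5)]] norm_grad_integrable[OF a] by blast
  show "has_weak_grad \<Omega> \<phi> (grad \<phi>)"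
    by (rule has_weak_grad_C1[OF \<Omega> Ck_on_subset[OF K(5)]]) simp
  have "integrable (lebesgue_on \<Omega>) (\<lambda>x. 1 * \<phi> x)"
    using L1_loc_continuous[OF continuous_on_const] K(1,2) \<Omega>_sets continuous_on_subset[OF Ck_on_continuous_on[OF K(5)]]
    by (rule integrable_L1_loc_mult) (use K(3) in auto)
  then show "integrable (lebesgue_on \<Omega>) \<phi>" by simp
qed

lemma unit_field_inner_integrable:
  assumes "integrable (lebesgue_on \<Omega>) P"
  shows "integrable (lebesgue_on \<Omega>) (\<lambda>x. ((1 / norm (G x)) *\<^sub>R G x) \<bullet> P x)"
proof (rule Bochner_Integration.integrable_bound)
  note [measurable] = G_measurable borel_measurable_integrable[OF assms]
  show "integrable (lebesgue_on \<Omega>) (\<lambda>x. norm (P x))" using assms by (rule integrable_norm)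
  show "(\<lambda>x. ((1 / norm (G x)) *\<^sub>R G x) \<bullet> P x) \<in> borel_measurable (lebesgue_on \<Omega>)" by measurable
  have "\<bar>((1 / norm (G x)) *\<^sub>R G x) \<bullet> P x\<bar> \<le> norm (P x)" for x
    using Cauchy_Schwarz_ineq2[of "(1 / norm (G x)) *\<^sub>R G x" "P x"] by (cases "G x = 0") auto
  then show "AE x in lebesgue_on \<Omega>. norm (((1 / norm (G x)) *\<^sub>R G x) \<bullet> P x) \<le> norm (norm (P x))" by simp
qed

lemma H_mult_integrable:
  assumes "integrable (lebesgue_on \<Omega>) f"
  shows "integrable (lebesgue_on \<Omega>) (\<lambda>x. H x * f x)"
proof -
  obtain C where "H \<in> borel_measurable (lebesgue_on \<Omega>)" "AE x in lebesgue_on \<Omega>. \<bar>H x\<bar> \<le> C"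
    using H by (auto simp: L_infty_def)
  from integrable_scaleR_bounded[OF assms this] show ?thesis by simp
qed

text \<open>The left side is a linear functional bounded in the \<open>W11\<close> norm, since the
  unit field has norm at most 1 and H is essentially bounded by C. It vanishes on test functions,
  which approximate \<phi>.\<close>

lemma W11_0_weak_equation:
  assumes "W11_0 \<Omega> \<phi>"
  shows "(LINT x|lebesgue_on \<Omega>. ((1 / norm (G x)) *\<^sub>R G x) \<bullet> weak_grad \<Omega> \<phi> x + H x * \<phi> x) = 0"
proof -
  let ?N = "\<lambda>x. (1 / norm (G x)) *\<^sub>R G x"
  let ?P = "weak_grad \<Omega> \<phi>"
  have W: "has_weak_grad \<Omega> \<phi> ?P" "integrable (lebesgue_on \<Omega>) \<phi>" "integrable (lebesgue_on \<Omega>) ?P"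
    using assms has_weak_grad_weak_grad by (auto simp: W11_0_def W11_def)
  obtain C where C: "AE x in lebesgue_on \<Omega>. \<bar>H x\<bar> \<le> C" using H by (auto simp: L_infty_def)
  define L where "L = (LINT x|lebesgue_on \<Omega>. ?N x \<bullet> ?P x + H x * \<phi> x)"
  have "\<bar>L\<bar> \<le> (1 + \<bar>C\<bar>) * \<epsilon>" if \<epsilon>: "\<epsilon> > 0" for \<epsilon>
  proof -
    obtain \<psi> where \<psi>: "test_fun \<Omega> \<psi>" "W11_norm \<Omega> (\<lambda>x. \<phi> x - \<psi> x) < \<epsilon>"
      using assms \<epsilon> unfolding W11_0_def by blast
    note t = test_fun_weak_equation[OF \<psi>(1)]
    let ?Q = "\<lambda>x. ?P x - grad \<psi> x" and ?d = "\<lambda>x. \<phi> x - \<psi> x"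
    have "has_weak_grad \<Omega> ?d ?Q"
      using has_weak_grad_add_scaleR[OF \<Omega> W(1) t(6), of "-1"] by simp
    \<comment> \<open>The weak gradient inside \<open>W11_norm\<close> is a choice of its own;
      uniqueness identifies it almost everywhere with the difference of the two gradients.\<close>
    then have ae: "AE x in lebesgue_on \<Omega>. weak_grad \<Omega> ?d x = ?Q x"
      by (rule AE_weak_grad_eq[OF \<Omega>])
    have Q: "integrable (lebesgue_on \<Omega>) ?Q" and d: "integrable (lebesgue_on \<Omega>) ?d"
      using W t by simp_all
    have nQ: "(LINT x|lebesgue_on \<Omega>. norm (weak_grad \<Omega> ?d x)) = (LINT x|lebesgue_on \<Omega>. norm (?Q x))"
      by (rule integral_lebesgue_on_AE[OF \<Omega>_sets, symmetric])
        (use Q ae in \<open>auto elim!: eventually_mono intro!: borel_measurable_norm borel_measurable_integrable\<close>)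
    have "L = (LINT x|lebesgue_on \<Omega>. ?N x \<bullet> ?P x + H x * \<phi> x)
        - ((LINT x|lebesgue_on \<Omega>. ?N x \<bullet> grad \<psi> x) + (LINT x|lebesgue_on \<Omega>. H x * \<psi> x))"
      unfolding t(1) L_def by simp
    also have "\<dots> = (LINT x|lebesgue_on \<Omega>. ?N x \<bullet> ?Q x + H x * ?d x)"
      unfolding inner_diff_right right_diff_distrib
      using unit_field_inner_integrable[OF W(3)] H_mult_integrable[OF W(2)] t(2,3) by simp
    finally have L: "L = (LINT x|lebesgue_on \<Omega>. ?N x \<bullet> ?Q x + H x * ?d x)" .
    have "\<bar>L\<bar> \<le> (LINT x|lebesgue_on \<Omega>. \<bar>?N x \<bullet> ?Q x + H x * ?d x\<bar>)"
      unfolding L by (rule integral_abs_bound)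
    also have "\<dots> \<le> (LINT x|lebesgue_on \<Omega>. norm (?Q x) + \<bar>C\<bar> * \<bar>?d x\<bar>)"
    proof (rule integral_mono_AE)
      show "integrable (lebesgue_on \<Omega>) (\<lambda>x. \<bar>?N x \<bullet> ?Q x + H x * ?d x\<bar>)"
        by (intro integrable_abs Bochner_Integration.integrable_add unit_field_inner_integrable[OF Q] H_mult_integrable[OF d])
      show "integrable (lebesgue_on \<Omega>) (\<lambda>x. norm (?Q x) + \<bar>C\<bar> * \<bar>?d x\<bar>)"
        by (intro Bochner_Integration.integrable_add integrable_norm[OF Q] integrable_mult_right integrable_abs[OF d])
      show "AE x in lebesgue_on \<Omega>. \<bar>?N x \<bullet> ?Q x + H x * ?d x\<bar> \<le> norm (?Q x) + \<bar>C\<bar> * \<bar>?d x\<bar>"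
        using C
      proof eventually_elim
        case (elim x)
        have "\<bar>?N x \<bullet> ?Q x\<bar> \<le> norm (?Q x)"
          using Cauchy_Schwarz_ineq2[of "?N x" "?Q x"] by (cases "G x = 0") auto
        moreover have "\<bar>H x * ?d x\<bar> \<le> \<bar>C\<bar> * \<bar>?d x\<bar>"
          unfolding abs_mult using elim by (intro mult_right_mono) auto
        ultimately show ?case by linarith
      qed
    qed
    also have "\<dots> = (LINT x|lebesgue_on \<Omega>. norm (?Q x)) + \<bar>C\<bar> * (LINT x|lebesgue_on \<Omega>. \<bar>?d x\<bar>)"
      using integrable_norm[OF Q] integrable_abs[OF d] by simp
    also have "\<dots> \<le> (1 + \<bar>C\<bar>) * W11_norm \<Omega> ?d"
    proof -
      have "(LINT x|lebesgue_on \<Omega>. norm (?Q x)) \<ge> 0" "(LINT x|lebesgue_on \<Omega>. \<bar>?d x\<bar>) \<ge> 0" by simp_all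
      then show ?thesis
        unfolding W11_norm_def nQ by (simp add: algebra_simps)
    qed
    also have "\<dots> \<le> (1 + \<bar>C\<bar>) * \<epsilon>" using \<psi>(2) by (intro mult_left_mono) auto
    finally show ?thesis .
  qed
  note le = this
  have "\<bar>L\<bar> \<le> \<epsilon>" if "\<epsilon> > 0" for \<epsilon>
    using le[of "\<epsilon> / (1 + \<bar>C\<bar>)"] that by (simp add: add_pos_nonneg)
  then have "\<bar>L\<bar> \<le> 0" by (rule field_le_epsilon[where y = 0, simplified])
  then show ?thesis by (simp add: L_def)
qed

end

text \<open>The subgradient inequality for the norm at a: the left side is the inner product of the
  unit vector along a with a + b, so Cauchy-Schwarz applies.\<close>

lemma norm_add_ge_unit_inner:
  fixes a b :: "'a::real_inner"
  assumes "a \<noteq> 0"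
  shows "norm a + ((1 / norm a) *\<^sub>R a) \<bullet> b \<le> norm (a + b)"
proof -
  have "norm a + ((1 / norm a) *\<^sub>R a) \<bullet> b = ((1 / norm a) *\<^sub>R a) \<bullet> (a + b)"
    using assms by (simp add: inner_add_right power2_norm_eq_inner[symmetric] power2_eq_square)
  also have "\<dots> \<le> norm ((1 / norm a) *\<^sub>R a) * norm (a + b)" by (rule norm_cauchy_schwarz)
  also have "\<dots> = norm (a + b)" using assms by simp
  finally show ?thesis .
qed

theorem theoremE:
  fixes \<Omega> :: "(real^'n::finite) set"
    and F :: "real^'n \<Rightarrow> real^'n"
    and H u :: "real^'n \<Rightarrow> real"
  assumes "CARD('n) \<ge> 2"
    and "open \<Omega>" and "connected \<Omega>" and "\<Omega> \<noteq> {}" and "bounded \<Omega>"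
    and "\<And>I. Ck_on 1 (\<lambda>x. F x $ I) \<Omega>"
    and "Ck_on 2 u \<Omega>" and "continuous_on (closure \<Omega>) u"
    and "C2_smooth_solution \<Omega> F H u"
    and "continuous_on (\<Omega> - sing_set \<Omega> F (grad u)) H" and "L_infty \<Omega> H"
    and "\<And>p. p \<in> \<Omega> \<Longrightarrow> (rank (curl_matrix F p) + 1) div 2 \<ge> 2"
  shows "weak_solution \<Omega> F H u \<and>
    (W11 \<Omega> u \<and> integrable (lebesgue_on \<Omega>) F \<longrightarrow> minimizer \<Omega> F H u)"
proof -
  define G where "G x = grad u x + F x" for x
  note \<Omega> = \<open>open \<Omega>\<close>
  have F1: "Ck_on (Suc 0) (\<lambda>x. F x $ i) \<Omega>" for i using assms(6)[of i] by (simp only: One_nat_def)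
  have u2: "Ck_on (Suc (Suc 0)) u \<Omega>" using assms(7) by (simp only: numeral_2_eq_2)
  have pu: "Ck_on (Suc 0) (partial_deriv i u) \<Omega>" for i using u2 by (subst (asm) Ck_on.simps(2)) blast
  have G1: "Ck_on (Suc 0) (\<lambda>x. G x $ i) \<Omega>" for i
    unfolding G_def vector_add_component grad_nth by (rule Ck_on_add[OF \<Omega> pu F1])
  interpret unit_field_equation \<Omega> G H
  proof
    show "rank (\<chi> i j. jac G p $ i $ j - jac G p $ j $ i) > 2" if p: "p \<in> \<Omega>" for p
    proof -
      have "jac G p $ i $ j = partial_deriv j (partial_deriv i u) p + partial_deriv j (\<lambda>x. F x $ i) p" for i j
        using partial_deriv_add[of "partial_deriv i u" p "\<lambda>x. F x $ i" j] pu[of i] F1[of i] p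
        by (simp add: jac_def G_def)
      \<comment> \<open>The Hessian of u is symmetric and drops out of the skew part.\<close>
      then have "(\<chi> i j. jac G p $ i $ j - jac G p $ j $ i) = curl_matrix F p"
        using partial_deriv_commute[OF assms(7) \<Omega> p] by (simp add: curl_matrix_def vec_eq_iff)
      \<comment> \<open>\<open>(rank + 1) div 2 \<ge> 2\<close> means that rank + 1 is at least 4,
        so the rank is at least 3.\<close>
      with assms(12)[OF p] show ?thesis by simp
    qed
    show "divergence (\<lambda>y. (1 / norm (G y)) *\<^sub>R G y) x = H x" if "x \<in> \<Omega>" "G x \<noteq> 0" for x
      using assms(9) that unfolding C2_smooth_solution_def unit_field_def[abs_def]
      by (simp add: sing_set_def G_def)
  qed (use \<Omega> G1 assms(11) in auto)
  define W where "W = weak_grad \<Omega> u"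
  have wd: "has_weak_grad \<Omega> u (grad u)" by (rule has_weak_grad_C1[OF \<Omega> Ck_on_SucD[OF u2]])
  have aeW: "AE x in lebesgue_on \<Omega>. W x = grad u x"
    unfolding W_def by (rule AE_weak_grad_eq[OF \<Omega> wd])
  \<comment> \<open>Bridge between the definitions, which use the chosen weak gradient W, and the
    classical field G: they agree, and are nonzero, off a null set.\<close>
  have aeG: "AE x in lebesgue_on \<Omega>. W x + F x = G x \<and> G x \<noteq> 0"
    using aeW AE_G_nonzero by eventually_elim (simp add: G_def)
  have "weak_solution \<Omega> F H u"
    unfolding weak_solution_def
  proof (intro conjI allI impI)
    show "L1_loc \<Omega> F" by (rule L1_loc_continuous[OF C1_on_vec_continuous_on[OF F1]])
    show "L1_loc \<Omega> H" by (rule L1_loc_L_infty[OF \<Omega> assms(11)])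
    show "weakly_differentiable \<Omega> u" using wd by (auto simp: weakly_differentiable_def)
    fix \<phi> :: "real^'n \<Rightarrow> real"
    assume \<phi>: "test_fun \<Omega> \<phi>"
    note t = test_fun_weak_equation[OF \<phi>]
    define T where "T = sing_set \<Omega> F (weak_grad \<Omega> u)"
    have T\<Omega>: "T \<subseteq> \<Omega>" by (auto simp: T_def sing_set_def)
    \<comment> \<open>The singular set formed with the weak gradient need not be the zero set of G,
      but it differs from it by a null set and is therefore null as well; its term in the weak
      inequality vanishes.\<close>
    have aeT: "AE x in lebesgue. x \<in> \<Omega> \<longrightarrow> x \<notin> T"
    proof -
      have "AE x in lebesgue. x \<in> \<Omega> \<longrightarrow> W x + F x = G x \<and> G x \<noteq> 0"
        using aeG \<Omega>_sets by (simp only: AE_restrict_space_iff space_lebesgue_on sets.Int_space_eq1 Int_UNIV_right space_completion space_lborel space_borel)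
      then show ?thesis by eventually_elim (auto simp: T_def sing_set_def W_def[symmetric])
    qed
    then obtain N where N: "N \<in> null_sets lebesgue" "{x \<in> space lebesgue. \<not> (x \<in> \<Omega> \<longrightarrow> x \<notin> T)} \<subseteq> N"
      by (auto simp only: eventually_ae_filter)
    have "T \<subseteq> N" using N(2) T\<Omega> by auto
    then have "negligible T"
      using N(1) negligible_subset by (auto simp: negligible_iff_null_sets)
    then have T: "T \<in> null_sets lebesgue" by (simp add: negligible_iff_null_sets)
    have 1: "(LINT x|lebesgue_on T. norm (grad \<phi> x)) = 0"
      by (rule integral_eq_zero_null_sets[OF T])
    have "(LINT x|lebesgue_on (\<Omega> - T). unit_field F (weak_grad \<Omega> u) x \<bullet> grad \<phi> x)
        = (LINT x|lebesgue_on \<Omega>. (if x \<in> \<Omega> - T then unit_field F (weak_grad \<Omega> u) x \<bullet> grad \<phi> x else 0))"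
      using T \<Omega>_sets by (intro integral_restrict[symmetric]) auto
    also have "\<dots> = (LINT x|lebesgue_on \<Omega>. ((1 / norm (G x)) *\<^sub>R G x) \<bullet> grad \<phi> x)"
    proof (rule integral_lebesgue_on_AE[OF \<Omega>_sets borel_measurable_integrable[OF t(2)], symmetric])
      show "AE x in lebesgue_on \<Omega>. ((1 / norm (G x)) *\<^sub>R G x) \<bullet> grad \<phi> x =
          (if x \<in> \<Omega> - T then unit_field F (weak_grad \<Omega> u) x \<bullet> grad \<phi> x else 0)"
        using aeG AE_space
        by eventually_elim (auto simp: T_def sing_set_def W_def[symmetric] unit_field_def)
    qed
    finally have 2: "(LINT x|lebesgue_on (\<Omega> - T). unit_field F (weak_grad \<Omega> u) x \<bullet> grad \<phi> x) =
        (LINT x|lebesgue_on \<Omega>. ((1 / norm (G x)) *\<^sub>R G x) \<bullet> grad \<phi> x)" .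
    \<comment> \<open>With the singular term gone, the weak inequality is the weak equation, so
      equality holds.\<close>
    show "0 \<le> (LINT x|lebesgue_on (sing_set \<Omega> F (weak_grad \<Omega> u)). norm (grad \<phi> x)) +
        (LINT x|lebesgue_on (\<Omega> - sing_set \<Omega> F (weak_grad \<Omega> u)). unit_field F (weak_grad \<Omega> u) x \<bullet> grad \<phi> x) +
        (LINT x|lebesgue_on \<Omega>. H x * \<phi> x)"
      unfolding T_def[symmetric] 1 2 using t(1) by simp
  qed
  moreover have "minimizer \<Omega> F H u" if u: "W11 \<Omega> u" and F: "integrable (lebesgue_on \<Omega>) F"
    unfolding minimizer_def
  proof (intro conjI allI impI)
    show "integrable (lebesgue_on \<Omega>) F" "L_infty \<Omega> H" "W11 \<Omega> u" by fact+
    have ui: "integrable (lebesgue_on \<Omega>) u" "integrable (lebesgue_on \<Omega>) W"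
      using u by (auto simp: W11_def W_def)
    fix \<phi> :: "real^'n \<Rightarrow> real"
    assume \<phi>: "W11_0 \<Omega> \<phi>"
    let ?P = "weak_grad \<Omega> \<phi>"
    have \<phi>i: "has_weak_grad \<Omega> \<phi> ?P" "integrable (lebesgue_on \<Omega>) \<phi>" "integrable (lebesgue_on \<Omega>) ?P"
      using \<phi> has_weak_grad_weak_grad by (auto simp: W11_0_def W11_def)
    have uw: "has_weak_grad \<Omega> u W"
      unfolding W_def using u by (intro has_weak_grad_weak_grad) (simp add: W11_def)
    have "has_weak_grad \<Omega> (\<lambda>x. u x + \<phi> x) (\<lambda>x. W x + ?P x)"
      using has_weak_grad_add_scaleR[OF \<Omega> uw \<phi>i(1), of 1] by simp
    then have ae: "AE x in lebesgue_on \<Omega>. weak_grad \<Omega> (\<lambda>x. u x + \<phi> x) x = W x + ?P x"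
      by (rule AE_weak_grad_eq[OF \<Omega>])
    let ?e0 = "\<lambda>x. norm (W x + F x) + H x * u x" and ?e1 = "\<lambda>x. norm (W x + ?P x + F x) + H x * (u x + \<phi> x)"
    have e0: "integrable (lebesgue_on \<Omega>) ?e0"
      using ui F by (intro Bochner_Integration.integrable_add integrable_norm H_mult_integrable)
    have e1: "integrable (lebesgue_on \<Omega>) ?e1"
      using ui \<phi>i F by (intro Bochner_Integration.integrable_add integrable_norm H_mult_integrable)
    have en: "energy \<Omega> F H (\<lambda>x. u x + \<phi> x) = integral\<^sup>L (lebesgue_on \<Omega>) ?e1"
      unfolding energy_def
    proof (rule integral_lebesgue_on_AE[OF \<Omega>_sets borel_measurable_integrable[OF e1], symmetric])
      show "AE x in lebesgue_on \<Omega>. ?e1 x = norm (weak_grad \<Omega> (\<lambda>x. u x + \<phi> x) x + F x) + H x * (u x + \<phi> x)"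
        using ae by eventually_elim simp
    qed
    let ?n = "\<lambda>x. ((1 / norm (G x)) *\<^sub>R G x) \<bullet> ?P x + H x * \<phi> x"
    have n: "integrable (lebesgue_on \<Omega>) ?n"
      using \<phi>i by (intro Bochner_Integration.integrable_add unit_field_inner_integrable H_mult_integrable)
    \<comment> \<open>Adding the integral of \<open>?n\<close>, which is 0 by the weak equation for
      \<phi>, reduces the comparison of energies to the pointwise subgradient inequality at G
      x.\<close>
    have "integral\<^sup>L (lebesgue_on \<Omega>) ?e0 = (LINT x|lebesgue_on \<Omega>. ?e0 x + ?n x)"
      using W11_0_weak_equation[OF \<phi>] Bochner_Integration.integral_add[OF e0 n] by simp
    also have "\<dots> \<le> integral\<^sup>L (lebesgue_on \<Omega>) ?e1"
    proof (rule integral_mono_AE[OF Bochner_Integration.integrable_add[OF e0 n] e1])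
      show "AE x in lebesgue_on \<Omega>. ?e0 x + ?n x \<le> ?e1 x"
        using aeG
      proof eventually_elim
        case (elim x)
        have "W x + ?P x + F x = (W x + F x) + ?P x" by (simp only: add_ac)
        also have "\<dots> = G x + ?P x" using elim by simp
        finally have eq: "W x + ?P x + F x = G x + ?P x" .
        from norm_add_ge_unit_inner[of "G x" "?P x"] elim show ?case
          unfolding eq by (simp add: distrib_left)
      qed
    qed
    finally show "energy \<Omega> F H u \<le> energy \<Omega> F H (\<lambda>x. u x + \<phi> x)"
      unfolding en by (simp add: energy_def W_def)
  qed
  ultimately show ?thesis by blast
qed

end
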